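(* Let $m\in\mathbb{N}_0$, $\vartheta\in[0,2]$, $K\in\mathcal{K}_{m,\vartheta}$ and $u\in\mathcal{C}_{\vartheta,K}$. Let $\tau:\mathbb{R}^n\to[0,1]$ be compactly supported and such that $\tau=1$ in $B_3$. Then there exist a function $f_{u,\tau}:\mathbb{R}^n\to\mathbb{R}$ and a polynomial $P_{u,\tau}$ of degree at most $m-1$ such that $$A(\tau u)=P_{u,\tau}+f_{u,\tau}\quad\text{in } B_1.$$ In addition, $f_{u,\tau}$ can be written in the following form: there exists $\psi:B_1\times B_3^c\to\mathbb{R}$ such that, for every multi-index $\gamma\in\mathbb{N}_0^n$, $$\sup_{x\in B_1}|\partial_x^\gamma\psi(x,y)|\le C\sup_{\substack{x\in B_1\\ m\le|\eta|\le m+|\gamma|}}|\partial_x^\eta K(x,y)|\qquad\text{for all }y\in B_3^c,$$ for a suitable constant $C>0$ depending only on $m$, $n$ and $|\gamma|$ (the right-hand side may be $+\infty$, in which case the bound is void), and such that in $B_1$ $$f_{u,\tau}=f_{1,u}+f_{2,u}+f^*_{u,\tau},$$ where $$f_{1,u}(x):=\int_{B_3}(u(x)-u(y))K(x,y)\,dy,\qquad f_{2,u}(x):=u(x)\int_{B_3^c}K(x,y)\,dy,\qquad f^*_{u,\tau}(x):=\int_{B_3^c}\tau(y)u(y)\psi(x,y)\,dy.$$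
   Context: $\mathbb{N}_0=\{0,1,2,\dots\}$. $B_r(x)$ is the open ball in $\mathbb{R}^n$ of radius $r$ centered at $x$, $B_r:=B_r(0)$, $\Omega^c:=\mathbb{R}^n\setminus\Omega$. All functions and kernels are real-valued and Lebesgue measurable. A polynomial of degree at most $-1$ is the zero polynomial. For a kernel $K=K(x,y)$ the operator $A$ is $$Au(x)=\lim_{\varepsilon\searrow0}\int_{\mathbb{R}^n\setminus B_\varepsilon(x)}(u(x)-u(y))K(x,y)\,dy,$$ and all integrals over sets containing a neighbourhood of a possible singularity $y=x$ are understood in this principal value sense. For $\vartheta\in[0,2]$, $\mathcal{C}_\vartheta$ is the set of $u\in L^1_{\rm loc}(\mathbb{R}^n)$ such that $u\in C(B_4)\cap L^\infty(B_4)$ if $\vartheta=0$; $u\in C^\vartheta(B_4)$ if $\vartheta\in(0,1)$; $u\in C^{0,1}(B_4)$ if $\vartheta=1$; $u\in C^{1,\vartheta-1}(B_4)$ if $\vartheta\in(1,2)$; $u\in C^{1,1}(B_4)$ if $\vartheta=2$ (Hölder spaces with finite norm on $B_4$). For $m\in\mathbb{N}_0$, $\vartheta\in[0,2]$, $\mathcal{K}_{m,\vartheta}$ is the set of kernels $K$ such that: for all $y\in B_3^c$ the map $B_1\ni x\mapsto K(x,y)$ is $C^m(B_1)$; $\int_{\mathbb{R}^n}\min\{|x-y|^\vartheta,1\}|K(x,y)|\,dy<+\infty$ for all $x\in B_1$; and, only if $\vartheta\in(1,2]$, additionally $K(x,x+z)=K(x,x-z)$ for all $x,z\in B_1$. Given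 $K\in\mathcal{K}_{m,\vartheta}$, $\mathcal{C}_{\vartheta,K}$ (which depends also on $m$) is the set of $u\in\mathcal{C}_\vartheta$ such that $$\sum_{|\alpha|\le m-1}\int_{B_R\setminus B_3}|u(y)|\,|\partial^\alpha_xK(x,y)|\,dy<+\infty\ \text{ for all }R>3,\ x\in B_1,\qquad \int_{B_3^c}|u(y)|\sup_{|\alpha|=m,\,x\in B_1}|\partial_x^\alpha K(x,y)|\,dy<+\infty.$$ Convention: in the bound for $\psi$, the right-hand side is regarded as $+\infty$ if one of the derivatives of $K$ involved fails to exist. *)

theory Defs
  imports "HOL-Analysis.Analysis"
begin

text \<open>A multi-index over the coordinates \<open>'n\<close> is a function \<open>\<alpha> :: 'n \<Rightarrow> nat\<close>.\<close>

definition msize :: "('n::finite \<Rightarrow> nat) \<Rightarrow> nat"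
  where "msize \<alpha> = (\<Sum>i\<in>UNIV. \<alpha> i)"

definition pdiff_at :: "'n::finite \<Rightarrow> (real^'n \<Rightarrow> real) \<Rightarrow> real^'n \<Rightarrow> bool"
  where "pdiff_at i f x \<longleftrightarrow> (\<lambda>t. f (x + t *\<^sub>R axis i 1)) field_differentiable at 0"

definition pderiv_at :: "'n::finite \<Rightarrow> (real^'n \<Rightarrow> real) \<Rightarrow> real^'n \<Rightarrow> real"
  where "pderiv_at i f x = deriv (\<lambda>t. f (x + t *\<^sub>R axis i 1)) 0"

fun pderivs :: "'n::finite list \<Rightarrow> (real^'n \<Rightarrow> real) \<Rightarrow> real^'n \<Rightarrow> real"
  where
    "pderivs [] f = f"
  | "pderivs (i # is) f = pderiv_at i (pderivs is f)"

fun pderivs_exist :: "(real^'n) set \<Rightarrow> 'n::finite list \<Rightarrow> (real^'n \<Rightarrow> real) \<Rightarrow> bool"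
  where
    "pderivs_exist U [] f \<longleftrightarrow> True"
  | "pderivs_exist U (i # is) f \<longleftrightarrow>
       pderivs_exist U is f \<and> (\<forall>x\<in>U. pdiff_at i (pderivs is f) x)"

definition orderings :: "('n::finite \<Rightarrow> nat) \<Rightarrow> 'n list set"
  where "orderings \<alpha> = {is. \<forall>i. count_list is i = \<alpha> i}"

text \<open>The derivative \<open>\<partial>\<^sup>\<alpha> f\<close> exists on the open set \<open>U\<close> if the iterated partial derivatives exist
  there in every order and do not depend on the order.  For a function all of whose iterated
  partial derivatives up to order \<open>k\<close> exist and are continuous, independence of the order is
  automatic (Schwarz), so \<open>Ck_on\<close> below is the usual class.\<close>

definition mderiv_exists :: "(real^'n) set \<Rightarrow> ('n::finite \<Rightarrow> nat) \<Rightarrow> (real^'n \<Rightarrow> real) \<Rightarrow> bool"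
  where "mderiv_exists U \<alpha> f \<longleftrightarrow>
    (\<forall>is\<in>orderings \<alpha>. pderivs_exist U is f) \<and>
    (\<forall>is\<in>orderings \<alpha>. \<forall>js\<in>orderings \<alpha>. \<forall>x\<in>U. pderivs is f x = pderivs js f x)"

definition mderiv :: "('n::finite \<Rightarrow> nat) \<Rightarrow> (real^'n \<Rightarrow> real) \<Rightarrow> real^'n \<Rightarrow> real"
  where "mderiv \<alpha> f = pderivs (SOME is. is \<in> orderings \<alpha>) f"

definition Ck_on :: "nat \<Rightarrow> (real^'n::finite) set \<Rightarrow> (real^'n \<Rightarrow> real) \<Rightarrow> bool"
  where "Ck_on k U f \<longleftrightarrow>
    (\<forall>\<alpha>. msize \<alpha> \<le> k \<longrightarrow> mderiv_exists U \<alpha> f \<and> continuous_on U (mderiv \<alpha> f))"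

text \<open>\<open>sup\<^bsub>x\<in>U\<^esub> \<bar>\<partial>\<^sup>\<alpha> f(x)\<bar>\<close>, with value \<open>\<infinity>\<close> if the derivative fails to exist on \<open>U\<close>.  Hence an upper
  bound \<open>sup_mderiv U \<alpha> f \<le> c\<close> with \<open>c < \<infinity>\<close> includes the existence of the derivative.\<close>

definition sup_mderiv :: "(real^'n) set \<Rightarrow> ('n::finite \<Rightarrow> nat) \<Rightarrow> (real^'n \<Rightarrow> real) \<Rightarrow> ennreal"
  where "sup_mderiv U \<alpha> f =
    (if mderiv_exists U \<alpha> f then (SUP x\<in>U. ennreal \<bar>mderiv \<alpha> f x\<bar>) else \<infinity>)"

text \<open>Polynomials of degree strictly less than \<open>m\<close>; for \<open>m = 0\<close> only the zero polynomial.\<close>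

definition poly_deg_less :: "nat \<Rightarrow> (real^'n::finite \<Rightarrow> real) \<Rightarrow> bool"
  where "poly_deg_less m P \<longleftrightarrow>
    (\<exists>c. \<forall>x. P x = (\<Sum>\<alpha> | msize \<alpha> < m. c \<alpha> * (\<Prod>i\<in>UNIV. (x $ i) ^ \<alpha> i)))"

definition has_pv_integral ::
    "(real^'n::finite \<Rightarrow> real) \<Rightarrow> real \<Rightarrow> real^'n \<Rightarrow> (real^'n) set \<Rightarrow> bool"
  where "has_pv_integral g l x S \<longleftrightarrow>
    (\<forall>\<epsilon>>0. set_integrable lebesgue (S - ball x \<epsilon>) g) \<and>
    ((\<lambda>\<epsilon>. LINT y:(S - ball x \<epsilon>)|lebesgue. g y) \<longlongrightarrow> l) (at_right 0)"

definition pv_integrable :: "(real^'n::finite \<Rightarrow> real) \<Rightarrow> real^'n \<Rightarrow> (real^'n) set \<Rightarrow> bool"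
  where "pv_integrable g x S \<longleftrightarrow> (\<exists>l. has_pv_integral g l x S)"

definition pv_integral :: "(real^'n::finite \<Rightarrow> real) \<Rightarrow> real^'n \<Rightarrow> (real^'n) set \<Rightarrow> real"
  where "pv_integral g x S = (THE l. has_pv_integral g l x S)"

definition A_defined ::
    "(real^'n::finite \<Rightarrow> real^'n \<Rightarrow> real) \<Rightarrow> (real^'n \<Rightarrow> real) \<Rightarrow> real^'n \<Rightarrow> bool"
  where "A_defined K v x \<longleftrightarrow> pv_integrable (\<lambda>y. (v x - v y) * K x y) x UNIV"

definition A_op ::
    "(real^'n::finite \<Rightarrow> real^'n \<Rightarrow> real) \<Rightarrow> (real^'n \<Rightarrow> real) \<Rightarrow> real^'n \<Rightarrow> real"
  where "A_op K v x = pv_integral (\<lambda>y. (v x - v y) * K x y) x UNIV"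

definition L1_loc :: "(real^'n::finite \<Rightarrow> real) \<Rightarrow> bool"
  where "L1_loc u \<longleftrightarrow>
    u \<in> borel_measurable lebesgue \<and> (\<forall>S. compact S \<longrightarrow> set_integrable lebesgue S u)"

text \<open>The space \<open>C\<^bsup>k,\<beta>\<^esup>(U)\<close>, finite norm included, for \<open>\<beta> \<in> (0,1]\<close>.\<close>

definition Holder_on :: "nat \<Rightarrow> real \<Rightarrow> (real^'n::finite) set \<Rightarrow> (real^'n \<Rightarrow> real) \<Rightarrow> bool"
  where "Holder_on k \<beta> U f \<longleftrightarrow>
    Ck_on k U f \<and>
    (\<forall>\<alpha>. msize \<alpha> \<le> k \<longrightarrow> bounded (mderiv \<alpha> f ` U)) \<and>
    (\<forall>\<alpha>. msize \<alpha> = k \<longrightarrow>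
       (\<exists>L. \<forall>x\<in>U. \<forall>y\<in>U. \<bar>mderiv \<alpha> f x - mderiv \<alpha> f y\<bar> \<le> L * dist x y powr \<beta>))"

definition C_class :: "real \<Rightarrow> (real^'n::finite \<Rightarrow> real) set"
  where "C_class \<theta> = {u. L1_loc u \<and>
    (if \<theta> = 0 then continuous_on (ball 0 4) u \<and> bounded (u ` ball 0 4)
     else if \<theta> \<le> 1 then Holder_on 0 \<theta> (ball 0 4) u
     else Holder_on 1 (\<theta> - 1) (ball 0 4) u)}"

text \<open>Joint Lebesgue measurability only gives measurability of almost every slice \<open>K x\<close>; since the
  integrals of \<open>K x\<close> are to be meaningful for every \<open>x\<close> in the unit ball, measurability of these
  slices is listed separately.  (That \<open>0 powr 0 = 0\<close> only affects the null set \<open>y = x\<close>.)\<close>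

definition kernel_class :: "nat \<Rightarrow> real \<Rightarrow> (real^'n::finite \<Rightarrow> real^'n \<Rightarrow> real) set"
  where "kernel_class m \<theta> = {K.
    (\<lambda>(x, y). K x y) \<in> borel_measurable lebesgue \<and>
    (\<forall>x\<in>ball 0 1. K x \<in> borel_measurable lebesgue) \<and>
    (\<forall>y\<in>- ball 0 3. Ck_on m (ball 0 1) (\<lambda>x. K x y)) \<and>
    (\<forall>x\<in>ball 0 1.
       (\<integral>\<^sup>+y. ennreal (min (dist x y powr \<theta>) 1 * \<bar>K x y\<bar>) \<partial>lebesgue) < \<infinity>) \<and>
    (1 < \<theta> \<longrightarrow> (\<forall>x\<in>ball 0 1. \<forall>z\<in>ball 0 1. K x (x + z) = K x (x - z)))}"

definition C_class_K ::
    "nat \<Rightarrow> real \<Rightarrow> (real^'n::finite \<Rightarrow> real^'n \<Rightarrow> real) \<Rightarrow> (real^'n \<Rightarrow> real) set"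
  where "C_class_K m \<theta> K = {u \<in> C_class \<theta>.
    (\<forall>R>3. \<forall>x\<in>ball 0 1.
       (\<Sum>\<alpha> | msize \<alpha> < m.
          \<integral>\<^sup>+y\<in>ball 0 R - ball 0 3. ennreal (\<bar>u y\<bar> * \<bar>mderiv \<alpha> (\<lambda>x. K x y) x\<bar>) \<partial>lebesgue) < \<infinity>) \<and>
    (\<integral>\<^sup>+y\<in>- ball 0 3. ennreal \<bar>u y\<bar> *
       (SUP \<alpha>\<in>{\<alpha>. msize \<alpha> = m}. sup_mderiv (ball 0 1) \<alpha> (\<lambda>x. K x y)) \<partial>lebesgue) < \<infinity>}"

definition cutoff :: "(real^'n::finite \<Rightarrow> real) \<Rightarrow> bool"
  where "cutoff \<tau> \<longleftrightarrow>
    \<tau> \<in> borel_measurable lebesgue \<and> (\<forall>x. \<tau> x \<in> {0..1}) \<and>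
    compact (closure {x. \<tau> x \<noteq> 0}) \<and> (\<forall>x\<in>ball 0 3. \<tau> x = 1)"

definition f1 :: "(real^'n::finite \<Rightarrow> real^'n \<Rightarrow> real) \<Rightarrow> (real^'n \<Rightarrow> real) \<Rightarrow> real^'n \<Rightarrow> real"
  where "f1 K u x = pv_integral (\<lambda>y. (u x - u y) * K x y) x (ball 0 3)"

definition f2 :: "(real^'n::finite \<Rightarrow> real^'n \<Rightarrow> real) \<Rightarrow> (real^'n \<Rightarrow> real) \<Rightarrow> real^'n \<Rightarrow> real"
  where "f2 K u x = u x * (LINT y:(- ball 0 3)|lebesgue. K x y)"

definition f_star :: "(real^'n::finite \<Rightarrow> real^'n \<Rightarrow> real) \<Rightarrow> (real^'n \<Rightarrow> real) \<Rightarrow>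
    (real^'n \<Rightarrow> real) \<Rightarrow> real^'n \<Rightarrow> real"
  where "f_star \<psi> u \<tau> x = (LINT y:(- ball 0 3)|lebesgue. \<tau> y * u y * \<psi> x y)"

definition decomposition_converges :: "(real^'n::finite \<Rightarrow> real^'n \<Rightarrow> real) \<Rightarrow>
    (real^'n \<Rightarrow> real^'n \<Rightarrow> real) \<Rightarrow> (real^'n \<Rightarrow> real) \<Rightarrow> (real^'n \<Rightarrow> real) \<Rightarrow> real^'n \<Rightarrow> bool"
  where "decomposition_converges K \<psi> u \<tau> x \<longleftrightarrow>
    pv_integrable (\<lambda>y. (u x - u y) * K x y) x (ball 0 3) \<and>
    set_integrable lebesgue (- ball 0 3) (K x) \<and>
    set_integrable lebesgue (- ball 0 3) (\<lambda>y. \<tau> y * u y * \<psi> x y)"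

end

(* Take psi(x,y) = T(x,y) - K(x,y), where T(.,y) is the Taylor polynomial of K(.,y) at 0 of degree
   m - 1.  On the complement of B_3 the integrand of A(tau u) is u(x) K(x,y) - tau(y) u(y) K(x,y);
   replacing the second K by T - psi splits off a polynomial of degree at most m - 1 in x.  A derivative
   of psi of order j <= m is again a Taylor remainder, of order m - j, of a derivative of K of order j,
   and hence bounded by the derivatives of K of order m; beyond order m the polynomial disappears.
   Inside B_3 the principal value converges absolutely for theta <= 1; for theta > 1 the linear part of
   u at x is odd about x and the kernel even, so it contributes nothing. *)
theory Submission
  imports Defs "HOL-Library.Multiset"
begin

section \<open>Differentiability from continuous partial derivatives\<close>

text \<open>The hypotheses on \<open>K\<close> concern derivatives along coordinate axes, whereas
  the remainder formula needs derivatives along the ray from 0 to \<open>x\<close>; continuity of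
  the partial derivatives bridges the two. Independence of the order of differentiation is built
  into \<open>mderiv_exists\<close>, so words of coordinates may be permuted freely up to order
  \<open>m\<close>. The constant is \<open>CARD('n) ^ m\<close> for every size of \<gamma>: a
  remainder of order p \<le> m is a sum over n^p words, each with a monomial bounded by 1 in the
  unit ball, and the factor 1/p! is dropped. Each integrability condition of
  \<open>C_class_K\<close> has one purpose. The condition of order \<open>m\<close> is the bound for
  \<gamma> = 0 integrated against \<open>u\<close>, which makes \<open>f_star\<close> converge. The
  conditions of lower order, taken at x = 0 on the support of \<tau>, make the coefficients of the
  polynomial converge. Measurability is a separate obstacle: joint Lebesgue measurability does not
  give every slice and says nothing about derivatives. Slices of derivatives are limits of
  difference quotients, and \<open>f\<close> is defined through A(\<tau> u), itself a limit of
  truncated integrals.\<close>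

lemma pdiff_at_iff:
  "pdiff_at i f x \<longleftrightarrow>
    ((\<lambda>t. f (x + t *\<^sub>R axis i 1)) has_real_derivative pderiv_at i f x) (at 0)"
  unfolding pdiff_at_def pderiv_at_def
  by (metis field_differentiable_derivI field_differentiable_def)

lemma pderiv_atI:
  assumes "((\<lambda>t. f (x + t *\<^sub>R axis i 1)) has_real_derivative D) (at 0)"
  shows "pdiff_at i f x" "pderiv_at i f x = D"
  using assms DERIV_imp_deriv
  by (auto simp: pdiff_at_def pderiv_at_def field_differentiable_def)

text \<open>Formulas for derivatives are known in the unit ball only, so functions must be replaced
  by others that agree with them merely near the point.\<close>

lemma has_pderiv_cong:
  fixes f g :: "real^'n::finite \<Rightarrow> real"
  assumes "open U" "x \<in> U" "\<And>y. y \<in> U \<Longrightarrow> f y = g y"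
    and "((\<lambda>t. f (x + t *\<^sub>R axis i 1)) has_real_derivative D) (at 0)"
  shows "((\<lambda>t. g (x + t *\<^sub>R axis i 1)) has_real_derivative D) (at 0)"
proof -
  have "open ((\<lambda>t. x + t *\<^sub>R axis i 1) -` U)"
    by (intro open_vimage assms(1) continuous_intros)
  then show ?thesis
    by (rule has_field_derivative_transform_within_open[OF assms(4)]) (use assms in auto)
qed

lemma DERIV_coordinate_line:
  assumes "pdiff_at i f (y + t *\<^sub>R axis i 1)"
  shows "((\<lambda>s. f (y + s *\<^sub>R axis i 1)) has_real_derivative
      pderiv_at i f (y + t *\<^sub>R axis i 1)) (at t)"
proof -
  have "((\<lambda>s. f (y + (s + t) *\<^sub>R axis i 1)) has_real_derivative
      pderiv_at i f (y + t *\<^sub>R axis i 1)) (at 0)"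
    using assms unfolding pdiff_at_iff by (simp add: algebra_simps)
  then show ?thesis
    using DERIV_shift[of "\<lambda>s. f (y + s *\<^sub>R axis i 1)" _ 0 t] by simp
qed

text \<open>The increment from \<open>x\<close> to \<open>y\<close> is split into steps along single
  coordinates. On each step the mean value inequality compares the partial derivative with its value
  at \<open>x\<close>, to which it is close by continuity.\<close>

lemma has_derivative_continuous_pderivs:
  fixes f :: "real^'n::finite \<Rightarrow> real"
  assumes U: "open U" "x \<in> U"
    and d: "\<And>i y. y \<in> U \<Longrightarrow> pdiff_at i f y"
    and c: "\<And>i. continuous_on U (pderiv_at i f)"
  shows "(f has_derivative (\<lambda>h. \<Sum>i\<in>UNIV. h $ i * pderiv_at i f x)) (at x)"
  unfolding has_derivative_at_alt
proof (intro conjI allI impI)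
  show "bounded_linear (\<lambda>h. \<Sum>i\<in>UNIV. h $ i * pderiv_at i f x)"
    by (intro bounded_linear_sum bounded_linear_mult_const bounded_linear_vec_nth)
next
  fix e :: real assume e: "e > 0"
  \<comment> \<open>Division by the dimension compensates for the sum of the \<bar>h_i\<bar>, which
    is at most n times the norm of \<open>h\<close>.\<close>
  define e' where "e' = e / CARD('n)"
  have e': "e' > 0" using e by (simp add: e'_def)
  have "\<forall>i. \<exists>d>0. \<forall>y. dist y x < d \<longrightarrow> \<bar>pderiv_at i f y - pderiv_at i f x\<bar> < e'"
  proof
    fix i
    have "isCont (pderiv_at i f) x"
      using c U by (simp add: continuous_on_eq_continuous_at)
    then show "\<exists>d>0. \<forall>y. dist y x < d \<longrightarrow> \<bar>pderiv_at i f y - pderiv_at i f x\<bar> < e'"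
      using e' by (auto simp: continuous_at_eps_delta dist_real_def)
  qed
  then obtain D where D: "\<And>i. D i > 0"
    "\<And>i y. dist y x < D i \<Longrightarrow> \<bar>pderiv_at i f y - pderiv_at i f x\<bar> < e'"
    by metis
  obtain r where r: "r > 0" "ball x r \<subseteq> U"
    using U openE by blast
  define \<delta> where "\<delta> = min r (Min (range D))"
  have \<delta>: "\<delta> > 0" using D r by (simp add: \<delta>_def)
  have pd: "\<bar>pderiv_at i f y - pderiv_at i f x\<bar> \<le> e'" "pdiff_at i f y" if "norm (y - x) < \<delta>" for i y
  proof -
    have "dist y x < D i" "dist y x < r"
      using that by (auto simp: \<delta>_def dist_norm)
    then show "\<bar>pderiv_at i f y - pderiv_at i f x\<bar> \<le> e'" "pdiff_at i f y"
      using D(2) r d by (force simp: mem_ball dist_commute)+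
  qed
  have "norm (f y - f x - (\<Sum>i\<in>UNIV. (y - x) $ i * pderiv_at i f x)) \<le> e * norm (y - x)"
    if y: "norm (y - x) < \<delta>" for y
  proof -
    define h where "h = y - x"
    \<comment> \<open>\<open>x + H A\<close> has already moved in the coordinates of
      \<open>A\<close>; enlarging \<open>A\<close> one element at a time leads from \<open>x\<close>
      to \<open>y\<close>.\<close>
    define H where "H A = (\<chi> k. if k \<in> A then h $ k else 0)" for A
    have "\<bar>f (x + H A) - f x - (\<Sum>i\<in>A. h $ i * pderiv_at i f x)\<bar> \<le> e' * (\<Sum>i\<in>A. \<bar>h $ i\<bar>)"
      if "finite A" for A
      using that
    proof induction
      case empty
      have "H {} = 0" by (simp add: H_def vec_eq_iff)
      then show ?case by simp
    next
      case (insert j A)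
      define \<phi> where "\<phi> s = f ((x + H A) + s *\<^sub>R axis j 1) - s * pderiv_at j f x" for s
      have H: "H (insert j A) = H A + (h $ j) *\<^sub>R axis j 1"
        using insert by (auto simp: H_def vec_eq_iff axis_def)
      have "norm (\<phi> (h $ j) - \<phi> 0) \<le> e' * norm (h $ j - 0)"
      proof (rule field_differentiable_bound)
        fix s assume "s \<in> closed_segment 0 (h $ j)"
        then have s: "\<bar>s\<bar> \<le> \<bar>h $ j\<bar>"
          by (auto simp: closed_segment_eq_real_ivl split: if_splits)
        \<comment> \<open>Every component is dominated by that of \<open>h\<close>, so the broken
          path never leaves the ball in which the partial derivatives are controlled.\<close>
        have "norm (H A + s *\<^sub>R axis j 1) \<le> norm h"
          by (rule norm_le_componentwise_cart) (use s insert in \<open>auto simp: H_def axis_def\<close>)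
        then have "norm ((x + H A + s *\<^sub>R axis j 1) - x) < \<delta>"
          using y by (simp add: h_def)
        note * = pd[OF this, of j]
        show "(\<phi> has_field_derivative
            (pderiv_at j f (x + H A + s *\<^sub>R axis j 1) - pderiv_at j f x)) (at s within closed_segment 0 (h $ j))"
          unfolding \<phi>_def
          by (rule has_field_derivative_at_within)
             (auto intro!: derivative_eq_intros DERIV_coordinate_line *)
        show "norm (pderiv_at j f (x + H A + s *\<^sub>R axis j 1) - pderiv_at j f x) \<le> e'"
          using * by simp
      qed auto
      then have "\<bar>f (x + H (insert j A)) - f (x + H A) - h $ j * pderiv_at j f x\<bar> \<le> e' * \<bar>h $ j\<bar>"
        by (simp add: \<phi>_def H algebra_simps)
      then show ?case
        using insert by (simp add: algebra_simps)
    qed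
    note * = this[OF finite[of UNIV]]
    have "x + H UNIV = y"
      by (simp add: H_def h_def vec_eq_iff)
    with * have "\<bar>f y - f x - (\<Sum>i\<in>UNIV. (y - x) $ i * pderiv_at i f x)\<bar> \<le> e' * (\<Sum>i\<in>UNIV. \<bar>h $ i\<bar>)"
      by (simp only: h_def)
    also have "\<dots> \<le> e' * (\<Sum>i\<in>(UNIV::'n set). norm h)"
      using e' by (intro mult_left_mono sum_mono) (auto simp: component_le_norm_cart)
    also have "\<dots> = e * norm (y - x)"
      by (simp add: e'_def h_def)
    finally show ?thesis by simp
  qed
  then show "\<exists>d>0. \<forall>y. norm (y - x) < d \<longrightarrow>
      norm (f y - f x - (\<Sum>i\<in>UNIV. (y - x) $ i * pderiv_at i f x)) \<le> e * norm (y - x)"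
    using \<delta> by blast
qed

text \<open>Chain rule in an arbitrary direction. It serves the Taylor expansion along rays from 0
  and the first-order expansion of \<open>u\<close> along segments.\<close>

lemma DERIV_line:
  fixes f :: "real^'n::finite \<Rightarrow> real"
  assumes U: "open U" "a + t *\<^sub>R v \<in> U"
    and d: "\<And>i y. y \<in> U \<Longrightarrow> pdiff_at i f y"
    and c: "\<And>i. continuous_on U (pderiv_at i f)"
  shows "((\<lambda>t. f (a + t *\<^sub>R v)) has_real_derivative
    (\<Sum>i\<in>UNIV. v $ i * pderiv_at i f (a + t *\<^sub>R v))) (at t)"
proof -
  have "((\<lambda>t. a + t *\<^sub>R v) has_derivative (\<lambda>s. s *\<^sub>R v)) (at t)"
    by (auto intro!: derivative_eq_intros)
  from has_derivative_compose[OF this has_derivative_continuous_pderivs[OF U d c]]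
  show ?thesis
    unfolding has_field_derivative_def
    by (rule has_derivative_eq_rhs) (auto simp: sum_distrib_left mult_ac)
qed

section \<open>Taylor remainders\<close>

lemma pderivs_append: "pderivs (v @ w) f = pderivs v (pderivs w f)"
  by (induction v) auto

lemma pderivs_exist_append:
  "pderivs_exist U (v @ w) f \<longleftrightarrow> pderivs_exist U w f \<and> pderivs_exist U v (pderivs w f)"
  by (induction v) (auto simp: pderivs_append)

lemma orderings_iff: "w \<in> orderings \<alpha> \<longleftrightarrow> count_list w = \<alpha>"
  by (auto simp: orderings_def)

lemma count_list_eq_iff_mset: "count_list v = count_list w \<longleftrightarrow> mset v = mset w"
  by (simp add: multiset_eq_iff count_mset fun_eq_iff)

lemma msize_count_list: "msize (count_list w) = length w"
  unfolding msize_def by (rule sum_count_set) auto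

text \<open>Over finitely many coordinates a multi-index is the count function of a multiset, and
  any enumeration of that multiset is an ordering. Without this the choice in \<open>mderiv\<close>
  would be arbitrary.\<close>

lemma orderings_nonempty: "orderings (\<alpha> :: 'n::finite \<Rightarrow> nat) \<noteq> {}"
proof -
  have "finite {x. 0 < \<alpha> x}" by simp
  then have *: "count (Abs_multiset \<alpha>) = \<alpha>"
    by (intro Abs_multiset_inverse) simp
  obtain w where "mset w = Abs_multiset \<alpha>"
    using ex_mset by blast
  then have "count (mset w) = \<alpha>"
    using * by simp
  then have "w \<in> orderings \<alpha>"
    by (auto simp: orderings_def count_mset fun_eq_iff)
  then show ?thesis by blast
qed

lemma mderiv_eq_pderivs:
  assumes "mderiv_exists U \<alpha> f" "w \<in> orderings \<alpha>" "x \<in> U"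
  shows "mderiv \<alpha> f x = pderivs w f x"
proof -
  have "(SOME w. w \<in> orderings \<alpha>) \<in> orderings \<alpha>"
    using assms(2) by (rule someI)
  then show ?thesis
    using assms unfolding mderiv_def mderiv_exists_def by blast
qed

lemma Ck_on_mderiv_exists: "Ck_on m U f \<Longrightarrow> length w \<le> m \<Longrightarrow> mderiv_exists U (count_list w) f"
  unfolding Ck_on_def by (simp add: msize_count_list)

lemma Ck_on_mderiv_eq_pderivs:
  "Ck_on m U f \<Longrightarrow> length w \<le> m \<Longrightarrow> x \<in> U \<Longrightarrow> mderiv (count_list w) f x = pderivs w f x"
  by (rule mderiv_eq_pderivs[OF Ck_on_mderiv_exists]) (auto simp: orderings_iff)

lemma Ck_on_pderivs_exist: "Ck_on m U f \<Longrightarrow> length w \<le> m \<Longrightarrow> pderivs_exist U w f"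
  using Ck_on_mderiv_exists[of m U f w] by (auto simp: mderiv_exists_def orderings_iff)

lemma Ck_on_pderivs_perm:
  assumes "Ck_on m U f" "length v \<le> m" "mset v = mset w" "x \<in> U"
  shows "pderivs v f x = pderivs w f x"
proof -
  have "v \<in> orderings (count_list v)" "w \<in> orderings (count_list v)"
    using assms(3) by (simp_all add: orderings_iff count_list_eq_iff_mset[symmetric])
  then show ?thesis
    using Ck_on_mderiv_exists[OF assms(1,2)] assms(4) unfolding mderiv_exists_def by blast
qed

lemma Ck_on_continuous_pderivs:
  assumes "Ck_on m U f" "length w \<le> m"
  shows "continuous_on U (pderivs w f)"
proof -
  have "continuous_on U (mderiv (count_list w) f)"
    using assms unfolding Ck_on_def by (simp add: msize_count_list)
  then show ?thesis
    by (rule continuous_on_eq) (rule Ck_on_mderiv_eq_pderivs[OF assms])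
qed

text \<open>Summing over words of length \<open>k\<close> instead of multi-indices of size \<open>k\<close> makes the multinomial
  coefficients disappear: the Taylor term of order \<open>k\<close> is \<open>word_sum k (\<lambda>w. pderivs w h 0) x / k!\<close>.\<close>

primrec word_sum :: "nat \<Rightarrow> ('n::finite list \<Rightarrow> real) \<Rightarrow> real^'n \<Rightarrow> real" where
  "word_sum 0 c x = c []"
| "word_sum (Suc k) c x = (\<Sum>i\<in>UNIV. x $ i * word_sum k (\<lambda>w. c (i # w)) x)"

lemma word_sum_cong:
  "(\<And>w. length w = k \<Longrightarrow> c w = d w) \<Longrightarrow> word_sum k c x = word_sum k d x"
proof (induction k arbitrary: c d)
  case (Suc k)
  have "word_sum k (\<lambda>w. c (i # w)) x = word_sum k (\<lambda>w. d (i # w)) x" for i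
    by (rule Suc.IH) (simp add: Suc.prems)
  then show ?case by simp
qed simp

text \<open>Linearity in the coefficients. With \<open>a i = x $ i\<close> and
  \<open>c i w = d (i # w)\<close> the right-hand side is \<open>word_sum (Suc k) d x\<close>; this
  is how differentiation along a ray raises the order.\<close>

lemma word_sum_sum_scale:
  "word_sum k (\<lambda>w. \<Sum>i\<in>A. a i * c i w) x = (\<Sum>i\<in>A. a i * word_sum k (c i) x)"
proof (induction k arbitrary: c)
  case (Suc k)
  have "word_sum (Suc k) (\<lambda>w. \<Sum>i\<in>A. a i * c i w) x =
      (\<Sum>j\<in>UNIV. \<Sum>i\<in>A. x $ j * (a i * word_sum k (\<lambda>w. c i (j # w)) x))"
    unfolding word_sum.simps Suc sum_distrib_left ..
  also have "\<dots> = (\<Sum>i\<in>A. a i * word_sum (Suc k) (c i) x)"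
    by (subst sum.swap) (simp add: sum_distrib_left mult.left_commute)
  finally show ?case .
qed simp

text \<open>There are n^k words of length \<open>k\<close>, and each coefficient is multiplied by a
  product of coordinates of modulus at most 1. This is the origin of the constant in the bound for
  \<psi>.\<close>

lemma word_sum_bound:
  fixes x :: "real^'n::finite"
  assumes "\<And>w. length w = k \<Longrightarrow> \<bar>c w\<bar> \<le> M" "\<And>i. \<bar>x $ i\<bar> \<le> 1"
  shows "\<bar>word_sum k c x\<bar> \<le> real CARD('n) ^ k * M"
  using assms(1)
proof (induction k arbitrary: c)
  case (Suc k)
  have "\<bar>word_sum (Suc k) c x\<bar> \<le> (\<Sum>i\<in>UNIV. \<bar>x $ i * word_sum k (\<lambda>w. c (i # w)) x\<bar>)"
    by simp
  also have "\<dots> \<le> (\<Sum>i\<in>(UNIV::'n set). real CARD('n) ^ k * M)"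
  proof (rule sum_mono)
    fix i
    have "\<bar>word_sum k (\<lambda>w. c (i # w)) x\<bar> \<le> real CARD('n) ^ k * M"
      by (rule Suc.IH) (simp add: Suc.prems)
    then show "\<bar>x $ i * word_sum k (\<lambda>w. c (i # w)) x\<bar> \<le> real CARD('n) ^ k * M"
      using mult_mono[OF assms(2)[of i]] by (fastforce simp: abs_mult)
  qed
  finally show ?case by simp
qed simp

text \<open>Each of the k + 1 positions of a word contributes once to the derivative. Symmetry of
  the coefficients lets the letter \<open>j\<close> be moved from any position to the front, so all
  contributions coincide; the resulting factor k + 1 later cancels against the factorial.\<close>

lemma has_pderiv_word_sum:
  fixes x :: "real^'n::finite"
  assumes "\<And>v w. length v = Suc k \<Longrightarrow> mset v = mset w \<Longrightarrow> c v = c w"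
  shows "((\<lambda>t. word_sum (Suc k) c (x + t *\<^sub>R axis j 1)) has_real_derivative
    real (Suc k) * word_sum k (\<lambda>w. c (j # w)) x) (at 0)"
  using assms
proof (induction k arbitrary: c)
  case 0
  have "((\<lambda>t. \<Sum>i\<in>UNIV. (x + t *\<^sub>R axis j 1) $ i * c [i]) has_real_derivative
      (\<Sum>i\<in>UNIV. (if i = j then c [i] else 0))) (at 0)"
    by (rule DERIV_sum) (auto intro!: derivative_eq_intros simp: axis_def)
  then show ?case by simp
next
  case (Suc k)
  have *: "((\<lambda>t. word_sum (Suc k) (\<lambda>w. c (i # w)) (x + t *\<^sub>R axis j 1)) has_real_derivative
      real (Suc k) * word_sum k (\<lambda>w. c (i # j # w)) x) (at 0)" for i
    by (rule Suc.IH) (simp add: Suc.prems)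
  have coord: "((\<lambda>t. (x + t *\<^sub>R axis j 1) $ i) has_real_derivative (if i = j then 1 else 0)) (at 0)" for i
    by (auto intro!: derivative_eq_intros simp: axis_def)
  have "((\<lambda>t. word_sum (Suc (Suc k)) c (x + t *\<^sub>R axis j 1)) has_real_derivative
      (\<Sum>i\<in>UNIV. (if i = j then 1 else 0) * word_sum (Suc k) (\<lambda>w. c (i # w)) (x + 0 *\<^sub>R axis j 1) +
        (real (Suc k) * word_sum k (\<lambda>w. c (i # j # w)) x) * (x + 0 *\<^sub>R axis j 1) $ i)) (at 0)"
    unfolding word_sum.simps(2)[of "Suc k" c] by (intro DERIV_sum DERIV_mult coord *)
  also have "(\<Sum>i\<in>UNIV. (if i = j then 1 else 0) * word_sum (Suc k) (\<lambda>w. c (i # w)) (x + 0 *\<^sub>R axis j 1) +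
        (real (Suc k) * word_sum k (\<lambda>w. c (i # j # w)) x) * (x + 0 *\<^sub>R axis j 1) $ i) =
      (\<Sum>i\<in>UNIV. (if i = j then word_sum (Suc k) (\<lambda>w. c (i # w)) x else 0)) +
      (\<Sum>i\<in>UNIV. real (Suc k) * (x $ i * word_sum k (\<lambda>w. c (i # j # w)) x))"
    unfolding sum.distrib[symmetric]
    by (intro sum.cong) (auto simp del: word_sum.simps)
  also have "\<dots> = word_sum (Suc k) (\<lambda>w. c (j # w)) x + real (Suc k) * (\<Sum>i\<in>UNIV. x $ i * word_sum k (\<lambda>w. c (i # j # w)) x)"
    by (simp add: sum_distrib_left del: word_sum.simps)
  also have "(\<Sum>i\<in>UNIV. x $ i * word_sum k (\<lambda>w. c (i # j # w)) x) = word_sum (Suc k) (\<lambda>w. c (j # w)) x"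
    unfolding word_sum.simps
    by (intro sum.cong arg_cong2[of _ _ _ _ times] word_sum_cong Suc.prems) auto
  finally show ?case by (simp add: algebra_simps)
qed

lemma DERIV_word_sum_coeff:
  assumes "\<And>w. length w = k \<Longrightarrow> ((\<lambda>t. c t w) has_real_derivative d w) (at s)"
  shows "((\<lambda>t. word_sum k (c t) x) has_real_derivative word_sum k d x) (at s)"
  using assms
proof (induction k arbitrary: c d)
  case (Suc k)
  have "((\<lambda>t. word_sum k (\<lambda>w. c t (i # w)) x) has_real_derivative word_sum k (\<lambda>w. d (i # w)) x) (at s)" for i
    by (rule Suc.IH) (simp add: Suc.prems)
  then show ?case
    by (auto intro!: DERIV_sum DERIV_cmult)
qed simp

section \<open>Polynomials in monomial form\<close>

lemma finite_msize_less: "finite {\<alpha> :: 'n::finite \<Rightarrow> nat. msize \<alpha> < p}"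
proof (rule finite_subset)
  show "{\<alpha> :: 'n \<Rightarrow> nat. msize \<alpha> < p} \<subseteq> Pi\<^sub>E UNIV (\<lambda>_. {..<p})"
  proof clarify
    fix \<alpha> :: "'n \<Rightarrow> nat" assume "msize \<alpha> < p"
    then have "\<alpha> i < p" for i
      using member_le_sum[of i UNIV \<alpha>] by (simp add: msize_def)
    then show "\<alpha> \<in> Pi\<^sub>E UNIV (\<lambda>_. {..<p})" by auto
  qed
qed (simp add: finite_PiE)

lemma poly_deg_less_0: "poly_deg_less p (\<lambda>x. 0)"
  unfolding poly_deg_less_def by (intro exI[of _ "\<lambda>_. 0"]) simp

lemma poly_deg_less_add:
  "poly_deg_less p P \<Longrightarrow> poly_deg_less p Q \<Longrightarrow> poly_deg_less p (\<lambda>x. P x + Q x)"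
  unfolding poly_deg_less_def
  by (elim exE, rule_tac x = "\<lambda>\<alpha>. c \<alpha> + ca \<alpha>" in exI) (simp add: sum.distrib algebra_simps)

lemma poly_deg_less_cmult: "poly_deg_less p P \<Longrightarrow> poly_deg_less p (\<lambda>x. a * P x)"
  unfolding poly_deg_less_def
  by (elim exE, rule_tac x = "\<lambda>\<alpha>. a * c \<alpha>" in exI) (simp add: sum_distrib_left algebra_simps)

lemma poly_deg_less_sum:
  "(\<And>i. i \<in> A \<Longrightarrow> poly_deg_less p (P i)) \<Longrightarrow> poly_deg_less p (\<lambda>x. \<Sum>i\<in>A. P i x)"
  by (induction A rule: infinite_finite_induct) (auto intro: poly_deg_less_add poly_deg_less_0)

lemma poly_deg_less_mono:
  assumes "poly_deg_less p P" "p \<le> q"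
  shows "poly_deg_less q P"
proof -
  obtain c where c: "\<And>x. P x = (\<Sum>\<alpha> | msize \<alpha> < p. c \<alpha> * (\<Prod>i\<in>UNIV. (x $ i) ^ \<alpha> i))"
    using assms(1) unfolding poly_deg_less_def by blast
  have "P x = (\<Sum>\<alpha> | msize \<alpha> < q. (if msize \<alpha> < p then c \<alpha> else 0) * (\<Prod>i\<in>UNIV. (x $ i) ^ \<alpha> i))" for x
    unfolding c using assms(2)
    by (intro sum.mono_neutral_cong_left finite_msize_less) auto
  then show ?thesis
    unfolding poly_deg_less_def by (intro exI allI)
qed

text \<open>Multiplication by x_j shifts the exponent of \<open>j\<close> by one. The shift
  \<open>s\<close> is injective on multi-indices, and the new coefficients \<open>c'\<close> vanish
  outside its image, that is, where the exponent of \<open>j\<close> is 0.\<close>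

lemma poly_deg_less_mult_coordinate:
  fixes P :: "real^'n::finite \<Rightarrow> real"
  assumes "poly_deg_less p P"
  shows "poly_deg_less (Suc p) (\<lambda>x. x $ j * P x)"
proof -
  obtain c where c: "\<And>x. P x = (\<Sum>\<alpha> | msize \<alpha> < p. c \<alpha> * (\<Prod>i\<in>UNIV. (x $ i) ^ \<alpha> i))"
    using assms(1) unfolding poly_deg_less_def by blast
  define s where "s \<alpha> = \<alpha>(j := Suc (\<alpha> j))" for \<alpha> :: "'n \<Rightarrow> nat"
  define c' where "c' \<beta> = (if 0 < \<beta> j then c (\<beta>(j := \<beta> j - 1)) else 0)" for \<beta>
  have size: "msize (s \<alpha>) = Suc (msize \<alpha>)" for \<alpha>
    unfolding msize_def s_def
    by (subst (1 2) sum.remove[of _ j]) (auto intro!: sum.cong)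
  have "x $ j * P x = (\<Sum>\<beta> | msize \<beta> < Suc p. c' \<beta> * (\<Prod>i\<in>UNIV. (x $ i) ^ \<beta> i))" for x
  proof -
    have "x $ j * P x = (\<Sum>\<alpha> | msize \<alpha> < p. c' (s \<alpha>) * (\<Prod>i\<in>UNIV. (x $ i) ^ s \<alpha> i))"
      unfolding c sum_distrib_left
    proof (intro sum.cong refl)
      fix \<alpha>
      have "(\<Prod>i\<in>UNIV. (x $ i) ^ s \<alpha> i) = x $ j * (\<Prod>i\<in>UNIV. (x $ i) ^ \<alpha> i)"
        by (subst (1 2) prod.remove[of _ j]) (auto simp: s_def intro!: prod.cong)
      then show "x $ j * (c \<alpha> * (\<Prod>i\<in>UNIV. (x $ i) ^ \<alpha> i)) = c' (s \<alpha>) * (\<Prod>i\<in>UNIV. (x $ i) ^ s \<alpha> i)"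
        by (simp add: c'_def s_def)
    qed
    also have "\<dots> = (\<Sum>\<beta>\<in>s ` {\<alpha>. msize \<alpha> < p}. c' \<beta> * (\<Prod>i\<in>UNIV. (x $ i) ^ \<beta> i))"
    proof (subst sum.reindex)
      show "inj_on s {\<alpha>. msize \<alpha> < p}"
      proof (rule inj_onI)
        fix a b assume "s a = s b"
        then have "s a i = s b i" for i by simp
        then show "a = b"
          by (metis (no_types) fun_upd_apply old.nat.inject s_def ext)
      qed
    qed simp
    also have "\<dots> = (\<Sum>\<beta> | msize \<beta> < Suc p. c' \<beta> * (\<Prod>i\<in>UNIV. (x $ i) ^ \<beta> i))"
    proof (rule sum.mono_neutral_left)
      show "\<forall>\<beta>\<in>{\<beta>. msize \<beta> < Suc p} - s ` {\<alpha>. msize \<alpha> < p}. c' \<beta> * (\<Prod>i\<in>UNIV. (x $ i) ^ \<beta> i) = 0"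
      proof
        fix \<beta> assume \<beta>: "\<beta> \<in> {\<beta>. msize \<beta> < Suc p} - s ` {\<alpha>. msize \<alpha> < p}"
        have "\<beta> j = 0"
        proof (rule ccontr)
          assume "\<beta> j \<noteq> 0"
          then have "s (\<beta>(j := \<beta> j - 1)) = \<beta>" by (auto simp: s_def)
          moreover have "msize (\<beta>(j := \<beta> j - 1)) < p"
            using size[of "\<beta>(j := \<beta> j - 1)"] calculation \<beta> by simp
          ultimately show False using \<beta> by (metis DiffD2 image_eqI mem_Collect_eq)
        qed
        then show "c' \<beta> * (\<Prod>i\<in>UNIV. (x $ i) ^ \<beta> i) = 0" by (simp add: c'_def)
      qed
    qed (auto simp: size finite_msize_less)
    finally show ?thesis .
  qed
  then show ?thesis unfolding poly_deg_less_def by (intro exI allI)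
qed

lemma poly_deg_less_const: "poly_deg_less (Suc 0) (\<lambda>x :: real^'n::finite. a)"
proof -
  have "{\<alpha> :: 'n \<Rightarrow> nat. msize \<alpha> < Suc 0} = {\<lambda>_. 0}"
    by (auto simp: msize_def)
  then show ?thesis
    unfolding poly_deg_less_def by (intro exI[of _ "\<lambda>_. a"]) simp
qed

lemma poly_deg_less_word_sum: "poly_deg_less (Suc k) (word_sum k c)"
proof (induction k arbitrary: c)
  case 0
  then show ?case using poly_deg_less_const[of "c []"] by (simp add: word_sum.simps(1)[abs_def])
next
  case (Suc k)
  show ?case
    unfolding word_sum.simps(2)[abs_def]
    by (intro poly_deg_less_sum poly_deg_less_mult_coordinate Suc)
qed

text \<open>The sign makes the function equal to its Taylor polynomial minus the defect. For
  \<open>p = 0\<close> the sum is empty and the defect is \<open>- h x\<close>; this degenerate case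
  covers all derivatives of order \<open>m\<close> and above.\<close>

definition taylor_defect :: "nat \<Rightarrow> (real^'n::finite \<Rightarrow> real) \<Rightarrow> real^'n \<Rightarrow> real" where
  "taylor_defect p h x = (\<Sum>k<p. word_sum k (\<lambda>w. pderivs w h 0) x / fact k) - h x"

text \<open>Lagrange remainder of t \<mapsto> h(t x) on [0,1]. Only nonempty words occur in
  \<open>cont\<close> because the case \<open>p = 0\<close> is applied to derivatives of order above
  \<open>m\<close>, whose continuity is unknown.\<close>

lemma taylor_defect_bound:
  fixes h :: "real^'n::finite \<Rightarrow> real"
  assumes ex: "\<And>w. length w \<le> p \<Longrightarrow> pderivs_exist (ball 0 1) w h"
    and cont: "\<And>w. w \<noteq> [] \<Longrightarrow> length w \<le> p \<Longrightarrow> continuous_on (ball 0 1) (pderivs w h)"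
    and M: "\<And>w y. length w = p \<Longrightarrow> y \<in> ball 0 1 \<Longrightarrow> \<bar>pderivs w h y\<bar> \<le> M"
    and x: "x \<in> ball 0 1"
  shows "\<bar>taylor_defect p h x\<bar> \<le> real CARD('n) ^ p * M"
proof -
  \<comment> \<open>This is the derivative of order \<open>k\<close> of t \<mapsto> h(t x), for k
    \<le> p.\<close>
  define D where "D k t = word_sum k (\<lambda>w. pderivs w h (t *\<^sub>R x)) x" for k t
  have inb: "t *\<^sub>R x \<in> ball 0 1" if "0 \<le> t" "t \<le> 1" for t
    using that x mult_left_le_one_le[of "norm x" t] by auto
  have "\<forall>k t. k < p \<and> 0 \<le> t \<and> t \<le> 1 \<longrightarrow> (D k has_real_derivative D (Suc k) t) (at t)"
  proof clarify
    fix k and t :: real assume k: "k < p" and t: "0 \<le> t" "t \<le> 1"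
    have "(D k has_real_derivative
        word_sum k (\<lambda>w. \<Sum>i\<in>UNIV. x $ i * pderivs (i # w) h (t *\<^sub>R x)) x) (at t)"
      unfolding D_def
    proof (rule DERIV_word_sum_coeff)
      fix w :: "'n list" assume w: "length w = k"
      have "((\<lambda>t. pderivs w h (0 + t *\<^sub>R x)) has_real_derivative
          (\<Sum>i\<in>UNIV. x $ i * pderiv_at i (pderivs w h) (0 + t *\<^sub>R x))) (at t)"
      proof (rule DERIV_line)
        show "pdiff_at i (pderivs w h) y" if "y \<in> ball 0 1" for i y
          using ex[of "i # w"] w k that by simp
        show "continuous_on (ball 0 1) (pderiv_at i (pderivs w h))" for i
          using cont[of "i # w"] w k by simp
      qed (use inb t in auto)
      then show "((\<lambda>t. pderivs w h (t *\<^sub>R x)) has_real_derivative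
          (\<Sum>i\<in>UNIV. x $ i * pderivs (i # w) h (t *\<^sub>R x))) (at t)"
        by simp
    qed
    then show "(D k has_real_derivative D (Suc k) t) (at t)"
      unfolding word_sum_sum_scale by (simp add: D_def)
  qed
  then obtain t where t: "0 < t" "t \<le> 1"
    and eq: "D 0 1 = (\<Sum>k<p. D k 0 / fact k * 1 ^ k) + D p t / fact p * 1 ^ p"
    using Maclaurin2[of 1 D "D 0" p] by auto
  have "taylor_defect p h x = - (D p t / fact p)"
    using eq by (simp add: taylor_defect_def D_def)
  also have "\<bar>\<dots>\<bar> \<le> \<bar>D p t\<bar>"
    using mult_right_mono[OF fact_ge_1[of p], of "\<bar>D p t\<bar>"] by (simp add: divide_le_eq mult.commute)
  also have "\<dots> \<le> real CARD('n) ^ p * M"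
    unfolding D_def
  proof (rule word_sum_bound)
    show "\<bar>x $ i\<bar> \<le> 1" for i
      using component_le_norm_cart[of x i] x by simp
  qed (use M inb t in auto)
  finally show ?thesis .
qed

text \<open>Differentiation commutes with taking the Taylor polynomial and lowers its order by one.
  The word may be longer than \<open>m\<close>: truncated subtraction then gives order 0, where only
  the negative of the derivative of \<open>g\<close> is left.\<close>

lemma pderivs_taylor_defect:
  fixes g :: "real^'n::finite \<Rightarrow> real"
  assumes g: "Ck_on m (ball 0 1) g" and w: "pderivs_exist (ball 0 1) w g"
  shows "pderivs_exist (ball 0 1) w (taylor_defect m g) \<and>
    (\<forall>x\<in>ball 0 1. pderivs w (taylor_defect m g) x = taylor_defect (m - length w) (pderivs w g) x)"
  using w
proof (induction w)
  case (Cons i w)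
  define h where "h = pderivs w g"
  define p where "p = m - length w"
  have ex: "pderivs_exist (ball 0 1) w g" and d: "\<And>x. x \<in> ball 0 1 \<Longrightarrow> pdiff_at i h x"
    using Cons.prems by (auto simp: h_def)
  note IH = Cons.IH[OF ex, folded h_def p_def]
  have "((\<lambda>t. taylor_defect p h (x + t *\<^sub>R axis i 1)) has_real_derivative
      taylor_defect (p - 1) (pderivs [i] h) x) (at 0)" if x: "x \<in> ball 0 1" for x
  proof -
    have dh: "((\<lambda>t. h (x + t *\<^sub>R axis i 1)) has_real_derivative pderivs [i] h x) (at 0)"
      using d[OF x] by (simp add: pdiff_at_iff)
    show ?thesis
    proof (cases p)
      case 0
      then show ?thesis
        using dh by (auto simp: taylor_defect_def intro!: derivative_eq_intros)
    next
      case (Suc q)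
      have len: "q + Suc (length w) = m" using Suc by (simp add: p_def)
      have "((\<lambda>t. word_sum (Suc k) (\<lambda>w. pderivs w h 0) (x + t *\<^sub>R axis i 1)) has_real_derivative
          real (Suc k) * word_sum k (\<lambda>v. pderivs v (pderivs [i] h) 0) x) (at 0)" if "k < q" for k
      proof -
        have "((\<lambda>t. word_sum (Suc k) (\<lambda>w. pderivs w h 0) (x + t *\<^sub>R axis i 1)) has_real_derivative
            real (Suc k) * word_sum k (\<lambda>v. pderivs (i # v) h 0) x) (at 0)"
        proof (rule has_pderiv_word_sum)
          fix v v' :: "'n list" assume "length v = Suc k" "mset v = mset v'"
          then show "pderivs v h 0 = pderivs v' h 0"
            unfolding h_def pderivs_append[symmetric] using len that
            by (intro Ck_on_pderivs_perm[OF g]) auto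
        qed
        \<comment> \<open>Differentiating the polynomial puts \<open>i\<close> outermost, while the
          Taylor coefficients of the derivative of \<open>h\<close> have \<open>i\<close> next to
          \<open>h\<close>. The total order is below \<open>m\<close>, so the letters may be
          permuted.\<close>
        also have "word_sum k (\<lambda>v. pderivs (i # v) h 0) x = word_sum k (\<lambda>v. pderivs v (pderivs [i] h) 0) x"
        proof (rule word_sum_cong)
          fix v :: "'n list" assume "length v = k"
          then have "pderivs (i # v @ w) g 0 = pderivs (v @ i # w) g 0"
            using len that by (intro Ck_on_pderivs_perm[OF g]) auto
          then show "pderivs (i # v) h 0 = pderivs v (pderivs [i] h) 0"
            by (simp add: h_def pderivs_append)
        qed
        finally show ?thesis .
      qed
      note * = DERIV_cdivide[OF this]
      have "((\<lambda>t. (pderivs [] h 0 +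
            (\<Sum>k<q. word_sum (Suc k) (\<lambda>w. pderivs w h 0) (x + t *\<^sub>R axis i 1) / fact (Suc k)))
            - h (x + t *\<^sub>R axis i 1)) has_real_derivative
          (0 + (\<Sum>k<q. real (Suc k) * word_sum k (\<lambda>v. pderivs v (pderivs [i] h) 0) x / fact (Suc k)))
            - pderivs [i] h x) (at 0)"
        by (rule DERIV_diff[OF DERIV_add[OF DERIV_const DERIV_sum[OF *]] dh]) auto
      moreover have "real (Suc k) * a / fact (Suc k) = a / fact k" for k and a :: real
        unfolding fact_Suc by (simp del: of_nat_Suc)
      ultimately show ?thesis
        unfolding taylor_defect_def Suc sum.lessThan_Suc_shift
        by (simp del: word_sum.simps(2) fact_Suc of_nat_Suc)
    qed
  qed
  note * = this
  have "((\<lambda>t. pderivs w (taylor_defect m g) (x + t *\<^sub>R axis i 1)) has_real_derivative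
      taylor_defect (p - 1) (pderivs [i] h) x) (at 0)" if x: "x \<in> ball 0 1" for x
    by (rule has_pderiv_cong[OF open_ball x _ *[OF x]]) (use IH in simp)
  from pderiv_atI[OF this] IH show ?case
    by (auto simp: p_def h_def)
qed simp

text \<open>An infinite right-hand side makes the bound void. A finite one yields existence of all
  derivatives of orders \<open>m\<close> to m + \<bar>\<gamma>\<bar> and a common bound
  \<open>M\<close>, and then the remainder estimate applies to the derivative of \<open>g\<close>
  along any ordering of \<gamma>.\<close>

lemma sup_mderiv_taylor_defect:
  fixes g :: "real^'n::finite \<Rightarrow> real"
  assumes g: "Ck_on m (ball 0 1) g"
  shows "sup_mderiv (ball 0 1) \<gamma> (taylor_defect m g) \<le> ennreal (real CARD('n) ^ m) *
    (SUP \<eta>\<in>{\<eta>. m \<le> msize \<eta> \<and> msize \<eta> \<le> m + msize \<gamma>}. sup_mderiv (ball 0 1) \<eta> g)"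
    (is "_ \<le> _ * ?R")
proof (cases "?R = \<infinity>")
  case True
  then show ?thesis unfolding True by (simp add: ennreal_mult_top)
next
  case False
  define M where "M = enn2real ?R"
  have R: "?R = ennreal M"
    using False unfolding M_def infinity_ennreal_def by (intro ennreal_enn2real[symmetric]) (simp only: top.not_eq_extremum)
  have M: "mderiv_exists (ball 0 1) \<eta> g" "\<And>y. y \<in> ball 0 1 \<Longrightarrow> \<bar>mderiv \<eta> g y\<bar> \<le> M"
    if "m \<le> msize \<eta>" "msize \<eta> \<le> m + msize \<gamma>" for \<eta>
  proof -
    have le: "sup_mderiv (ball 0 1) \<eta> g \<le> ennreal M"
      unfolding R[symmetric] using that by (intro SUP_upper) simp
    then show ex: "mderiv_exists (ball 0 1) \<eta> g"
      unfolding sup_mderiv_def by (auto split: if_splits simp: top_unique)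
    fix y :: "real^'n" assume y: "y \<in> ball 0 1"
    have "ennreal \<bar>mderiv \<eta> g y\<bar> \<le> (SUP x\<in>ball 0 1. ennreal \<bar>mderiv \<eta> g x\<bar>)"
      by (rule SUP_upper[OF y])
    also have "\<dots> \<le> ennreal M"
      using le ex by (simp add: sup_mderiv_def)
    finally show "\<bar>mderiv \<eta> g y\<bar> \<le> M"
      by (simp add: M_def)
  qed
  have len: "length w = msize \<gamma>" if "w \<in> orderings \<gamma>" for w
    using that by (auto simp: orderings_iff msize_count_list)
  \<comment> \<open>Up to order \<open>m\<close> existence is part of \<open>Ck_on\<close>; from
    order \<open>m\<close> on, \<gamma> itself belongs to the range of the finite supremum.\<close>
  have ex\<gamma>: "mderiv_exists (ball 0 1) \<gamma> g"
    using g M(1)[of \<gamma>] by (cases "msize \<gamma> \<le> m") (auto simp: Ck_on_def)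
  have exg: "pderivs_exist (ball 0 1) w g" if "w \<in> orderings \<gamma>" for w
    using ex\<gamma> that by (simp add: mderiv_exists_def)
  note pd = pderivs_taylor_defect[OF g exg]
  \<comment> \<open>Existence in the sense of \<open>mderiv_exists\<close> includes independence of
    the ordering. For the function value it is inherited from \<open>g\<close>, for the Taylor
    coefficients from symmetry below order \<open>m\<close>.\<close>
  have indep: "pderivs v (taylor_defect m g) x = pderivs w (taylor_defect m g) x"
    if vw: "v \<in> orderings \<gamma>" "w \<in> orderings \<gamma>" and x: "x \<in> ball 0 1" for v w x
  proof -
    have "pderivs v g x = pderivs w g x"
      using ex\<gamma> vw x unfolding mderiv_exists_def by blast
    moreover have "pderivs l (pderivs v g) 0 = pderivs l (pderivs w g) 0"
      if "length l < m - msize \<gamma>" for l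
      unfolding pderivs_append[symmetric] using vw len[OF vw(1)] that
      by (intro Ck_on_pderivs_perm[OF g]) (auto simp: orderings_iff count_list_eq_iff_mset[symmetric])
    ultimately have "taylor_defect (m - msize \<gamma>) (pderivs v g) x = taylor_defect (m - msize \<gamma>) (pderivs w g) x"
      unfolding taylor_defect_def
      by (intro arg_cong2[of _ _ _ _ minus] sum.cong arg_cong2[of _ _ _ _ divide] word_sum_cong) auto
    then show ?thesis
      using pd vw x len by auto
  qed
  have ex: "mderiv_exists (ball 0 1) \<gamma> (taylor_defect m g)"
    unfolding mderiv_exists_def using pd indep by blast
  obtain w where w: "w \<in> orderings \<gamma>"
    using orderings_nonempty by blast
  define p where "p = m - length w"
  have "\<bar>mderiv \<gamma> (taylor_defect m g) x\<bar> \<le> real CARD('n) ^ m * M" if x: "x \<in> ball 0 1" for x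
  proof -
    have "\<bar>taylor_defect p (pderivs w g) x\<bar> \<le> real CARD('n) ^ p * M"
    proof (rule taylor_defect_bound[OF _ _ _ x])
      fix v :: "'n list"
      show "pderivs_exist (ball 0 1) v (pderivs w g)" if "length v \<le> p"
      proof (cases "v = []")
        case False
        with that have "length (v @ w) \<le> m" by (cases v) (auto simp: p_def)
        then show ?thesis
          using Ck_on_pderivs_exist[OF g] pderivs_exist_append by blast
      qed simp
      show "continuous_on (ball 0 1) (pderivs v (pderivs w g))" if "v \<noteq> []" "length v \<le> p"
      proof -
        have "length (v @ w) \<le> m" using that by (cases v) (auto simp: p_def)
        then show ?thesis
          using Ck_on_continuous_pderivs[OF g] by (metis pderivs_append)
      qed
      fix y :: "real^'n" assume v: "length v = p" and y: "y \<in> ball 0 1"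
      \<comment> \<open>The total order is the maximum of \<open>m\<close> and \<bar>\<gamma>\<bar>,
        hence lies in the range of the supremum.\<close>
      have size: "m \<le> msize (count_list (v @ w))" "msize (count_list (v @ w)) \<le> m + msize \<gamma>"
        unfolding msize_count_list using v len[OF w] by (auto simp: p_def)
      have "mderiv (count_list (v @ w)) g y = pderivs (v @ w) g y"
        by (rule mderiv_eq_pderivs[OF M(1)[OF size] _ y]) (simp add: orderings_iff)
      then show "\<bar>pderivs v (pderivs w g) y\<bar> \<le> M"
        using M(2)[OF size y] by (simp add: pderivs_append)
    qed
    also have "\<dots> \<le> real CARD('n) ^ m * M"
      by (intro mult_right_mono power_increasing) (auto simp: p_def M_def)
    finally show ?thesis
      using pd[OF w] x mderiv_eq_pderivs[OF ex w x] by (simp add: p_def)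
  qed
  then have "sup_mderiv (ball 0 1) \<gamma> (taylor_defect m g) \<le> ennreal (real CARD('n) ^ m * M)"
    using ex by (auto simp: sup_mderiv_def intro!: SUP_least ennreal_leI)
  then show ?thesis
    using enn2real_nonneg[of ?R, folded M_def] unfolding R by (simp add: ennreal_mult)
qed

section \<open>Lebesgue measurability and principal values\<close>

text \<open>The target carries the completed sigma-algebra, so Borel measurability of the projection
  is not enough: preimages of null sets must be null. They are strips
  \<open>N \<times> UNIV\<close>, of measure 0 times infinity, which is 0.\<close>

lemma measurable_fst_lebesgue:
  "fst \<in> (lebesgue :: ('a::euclidean_space \<times> 'b::euclidean_space) measure) \<rightarrow>\<^sub>M lebesgue"
proof (rule completion.measurable_completion2)
  show m: "fst \<in> (lebesgue :: ('a \<times> 'b) measure) \<rightarrow>\<^sub>M lborel"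
    by (rule measurable_completion) (simp add: borel_prod[symmetric])
  show "null_sets lborel \<subseteq> null_sets (distr (lebesgue :: ('a \<times> 'b) measure) lborel fst)"
  proof
    fix N :: "'a set" assume N: "N \<in> null_sets lborel"
    have "emeasure (lborel :: ('a \<times> 'b) measure) (N \<times> UNIV) = 0"
      using N by (simp add: lborel_prod[symmetric] lborel.emeasure_pair_measure_Times null_sets_def)
    moreover have "N \<times> UNIV \<in> sets (borel :: ('a \<times> 'b) measure)"
      using N by (auto simp: borel_prod[symmetric] null_sets_def)
    moreover have "fst -` N = N \<times> (UNIV :: 'b set)" by auto
    ultimately show "N \<in> null_sets (distr (lebesgue :: ('a \<times> 'b) measure) lborel fst)"
      using N m by (auto simp: null_sets_def emeasure_distr)
  qed
qed

lemma measurable_snd_lebesgue: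
  "snd \<in> (lebesgue :: ('a::euclidean_space \<times> 'b::euclidean_space) measure) \<rightarrow>\<^sub>M lebesgue"
proof (rule completion.measurable_completion2)
  show m: "snd \<in> (lebesgue :: ('a \<times> 'b) measure) \<rightarrow>\<^sub>M lborel"
    by (rule measurable_completion) (simp add: borel_prod[symmetric])
  show "null_sets lborel \<subseteq> null_sets (distr (lebesgue :: ('a \<times> 'b) measure) lborel snd)"
  proof
    fix N :: "'b set" assume N: "N \<in> null_sets lborel"
    have "emeasure (lborel :: ('a \<times> 'b) measure) (UNIV \<times> N) = 0"
      using N by (simp add: lborel_prod[symmetric] lborel.emeasure_pair_measure_Times null_sets_def)
    moreover have "UNIV \<times> N \<in> sets (borel :: ('a \<times> 'b) measure)"
      using N by (auto simp: borel_prod[symmetric] null_sets_def)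
    moreover have "snd -` N = (UNIV :: 'a set) \<times> N" by auto
    ultimately show "N \<in> null_sets (distr (lebesgue :: ('a \<times> 'b) measure) lborel snd)"
      using N m by (auto simp: null_sets_def emeasure_distr)
  qed
qed

lemma borel_measurable_completion_AE:
  fixes f g :: "'a \<Rightarrow> real"
  assumes g: "g \<in> borel_measurable M" and ae: "AE x in M. f x = g x"
  shows "f \<in> borel_measurable (completion M)"
proof (rule measurableI)
  fix A :: "real set" assume A: "A \<in> sets borel"
  show "f -` A \<inter> space (completion M) \<in> sets (completion M)"
  proof (rule completion.in_sets_AE)
    show "AE x in completion M. x \<in> g -` A \<inter> space M \<longleftrightarrow> x \<in> f -` A \<inter> space (completion M)"
      using AE_completion[OF ae] by eventually_elim auto
    show "g -` A \<inter> space M \<in> sets (completion M)"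
      using measurable_sets[OF measurable_completion[OF g] A] by simp
  qed auto
qed simp

text \<open>A Borel version of \<open>g\<close> agrees with it almost everywhere, hence on almost
  every slice, and Fubini measurability holds for the Borel version. Slices that are not integrable
  cause no trouble, since the integral is then 0 for both versions.\<close>

lemma borel_measurable_lebesgue_section_integral:
  fixes g :: "'a::euclidean_space \<times> 'b::euclidean_space \<Rightarrow> real"
  assumes "g \<in> borel_measurable lebesgue"
  shows "(\<lambda>x. LINT y|lebesgue. g (x, y)) \<in> borel_measurable lebesgue"
proof -
  obtain g' where g': "g' \<in> borel_measurable lborel" "AE z in lborel. g z = g' z"
    using completion_ex_borel_measurable_real[OF assms] by blast
  have [measurable]: "g' \<in> borel_measurable (lborel \<Otimes>\<^sub>M lborel)"
    using g'(1) by (simp add: lborel_prod)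
  have "AE x in lborel. AE y in lborel. g (x, y) = g' (x, y)"
    using g'(2) by (intro lborel_pair.AE_pair) (simp only: lborel_prod)
  then have "AE x in lborel. (LINT y|lebesgue. g (x, y)) = (LINT y|lborel. g' (x, y))"
  proof eventually_elim
    case (elim x)
    have m: "(\<lambda>y. g' (x, y)) \<in> borel_measurable lborel" by measurable
    have "(LINT y|lebesgue. g (x, y)) = (LINT y|lebesgue. g' (x, y))"
      using borel_measurable_completion_AE[OF m elim] measurable_completion[OF m] AE_completion[OF elim]
      by (intro integral_cong_AE)
    then show ?case by (simp add: integral_completion[OF m])
  qed
  moreover have "(\<lambda>x. LINT y|lborel. g' (x, y)) \<in> borel_measurable lborel"
    by (rule lborel.borel_measurable_lebesgue_integral) simp
  ultimately show ?thesis
    by (rule borel_measurable_completion_AE[rotated])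
qed

lemma lebesgue_integral_reflect:
  fixes f :: "'a::euclidean_space \<Rightarrow> real"
  assumes "f \<in> borel_measurable lebesgue"
  shows "(LINT y|lebesgue. f (c - y)) = (LINT y|lebesgue. f y)"
proof -
  have T: "c + (\<Sum>j\<in>Basis. (- 1 * (y \<bullet> j)) *\<^sub>R j) = c - y" for y :: 'a
    by (simp add: sum_negf euclidean_representation)
  have eq: "lebesgue = distr lebesgue lebesgue (\<lambda>y. c - y)"
    using lebesgue_affine_euclidean[of "\<lambda>_. - 1" c] unfolding T by (simp add: density_1)
  have m: "(\<lambda>y. c - y) \<in> lebesgue \<rightarrow>\<^sub>M lebesgue"
    using lebesgue_affine_measurable[of "\<lambda>_. - 1" c] unfolding T by simp
  have "(LINT y|lebesgue. f y) = (LINT y|distr lebesgue lebesgue (\<lambda>y. c - y). f y)"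
    using eq by simp
  also have "\<dots> = (LINT y|lebesgue. f (c - y))"
    by (rule integral_distr[OF m assms])
  finally show ?thesis ..
qed

text \<open>Reflection at the centre \<open>c/2\<close> preserves Lebesgue measure and changes the
  sign of the integrand, so the integral equals its own negative.\<close>

lemma set_integral_odd:
  fixes k :: "'a::euclidean_space \<Rightarrow> real"
  assumes "set_integrable lebesgue S k"
    and "\<And>y. y \<in> S \<Longrightarrow> c - y \<in> S \<and> k (c - y) = - k y"
  shows "(LINT y:S|lebesgue. k y) = 0"
proof -
  define f where "f y = indicator S y *\<^sub>R k y" for y
  have "f \<in> borel_measurable lebesgue"
    using assms(1) unfolding set_integrable_def f_def[abs_def] by (rule borel_measurable_integrable)
  from lebesgue_integral_reflect[OF this, of c]
  have "(LINT y|lebesgue. f (c - y)) = (LINT y|lebesgue. f y)" .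
  moreover have "f (c - y) = - f y" for y
    using assms(2)[of y] assms(2)[of "c - y"] by (cases "y \<in> S"; cases "c - y \<in> S") (auto simp: f_def)
  ultimately show ?thesis
    by (simp add: set_lebesgue_integral_def f_def)
qed

section \<open>Calculus of principal values\<close>

lemma has_pv_integral_unique:
  assumes "has_pv_integral g l x S" "has_pv_integral g l' x S"
  shows "l = l'"
  using assms tendsto_unique[of "at_right (0::real)"] unfolding has_pv_integral_def by auto

lemma pv_integral_eq: "has_pv_integral g l x S \<Longrightarrow> pv_integral g x S = l"
  unfolding pv_integral_def by (blast intro: has_pv_integral_unique)

lemma has_pv_integral_cong:
  assumes "\<And>y. y \<in> S \<Longrightarrow> g y = g' y"
  shows "has_pv_integral g l x S \<longleftrightarrow> has_pv_integral g' l x S"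
proof -
  have "set_integrable lebesgue (S - ball x e) g = set_integrable lebesgue (S - ball x e) g'"
    "(LINT y:(S - ball x e)|lebesgue. g y) = (LINT y:(S - ball x e)|lebesgue. g' y)" for e
    unfolding set_integrable_def set_lebesgue_integral_def using assms
    by (intro Bochner_Integration.integrable_cong Bochner_Integration.integral_cong refl;
        auto simp: indicator_def)+
  then show ?thesis unfolding has_pv_integral_def by simp
qed

text \<open>Dominated convergence: the removed balls shrink to the point \<open>x\<close>, which is
  a null set.\<close>

lemma has_pv_integral_set_integrable:
  fixes g :: "real^'n::finite \<Rightarrow> real"
  assumes g: "set_integrable lebesgue S g" and S: "S \<in> sets lebesgue"
  shows "has_pv_integral g (LINT y:S|lebesgue. g y) x S"
proof -
  have int: "set_integrable lebesgue (S - ball x e) g" for e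
    using S by (intro set_integrable_subset[OF g]) auto
  have "((\<lambda>e. LINT y:(S - ball x e)|lebesgue. g y) \<longlongrightarrow> (LINT y:S|lebesgue. g y)) (at_right 0)"
    unfolding tendsto_at_iff_sequentially o_def
  proof (intro allI impI)
    fix X :: "nat \<Rightarrow> real" assume X: "\<forall>i. X i \<in> {0<..} - {0}" "X \<longlonglongrightarrow> 0"
    show "(\<lambda>i. LINT y:(S - ball x (X i))|lebesgue. g y) \<longlonglongrightarrow> (LINT y:S|lebesgue. g y)"
      unfolding set_lebesgue_integral_def
    proof (rule integral_dominated_convergence)
      show "(\<lambda>y. indicator S y *\<^sub>R g y) \<in> borel_measurable lebesgue"
        "(\<lambda>y. indicator (S - ball x (X i)) y *\<^sub>R g y) \<in> borel_measurable lebesgue" for i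
        using g int[of "X i"] unfolding set_integrable_def by auto
      show "integrable lebesgue (\<lambda>y. norm (indicator S y *\<^sub>R g y))"
        using g unfolding set_integrable_def by (rule integrable_norm)
      show "AE y in lebesgue. norm (indicator (S - ball x (X i)) y *\<^sub>R g y) \<le> norm (indicator S y *\<^sub>R g y)" for i
        by (rule AE_I2) (auto simp: indicator_def)
      show "AE y in lebesgue. (\<lambda>i. indicator (S - ball x (X i)) y *\<^sub>R g y) \<longlonglongrightarrow> indicator S y *\<^sub>R g y"
        using AE_completion[OF AE_lborel_singleton[of x]]
      proof eventually_elim
        case (elim y)
        then have "eventually (\<lambda>i. X i < dist x y) sequentially"
          using order_tendstoD(2)[OF X(2), of "dist x y"] by simp
        then have "eventually (\<lambda>i. indicator (S - ball x (X i)) y *\<^sub>R g y = indicator S y *\<^sub>R g y) sequentially"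
          by eventually_elim (auto simp: indicator_def)
        then show ?case by (rule tendsto_eventually)
      qed
    qed
  qed
  with int show ?thesis by (auto simp: has_pv_integral_def)
qed

text \<open>Truncations of radius below \<open>r\<close> do not touch \<open>B\<close>, so near the
  limit its contribution is constant.\<close>

lemma has_pv_integral_Un:
  fixes g :: "real^'n::finite \<Rightarrow> real"
  assumes A: "has_pv_integral g l x A" and B: "set_integrable lebesgue B g" "B \<in> sets lebesgue"
    and disj: "A \<inter> B = {}" "B \<inter> ball x r = {}" "r > 0"
  shows "has_pv_integral g (l + (LINT y:B|lebesgue. g y)) x (A \<union> B)"
proof -
  have int: "set_integrable lebesgue (A - ball x e) g" if "e > 0" for e
    using A that by (simp add: has_pv_integral_def)
  have intB: "set_integrable lebesgue (B - ball x e) g" for e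
    using B by (intro set_integrable_subset[OF B(1)]) auto
  have "((\<lambda>e. (LINT y:(A - ball x e)|lebesgue. g y) + (LINT y:B|lebesgue. g y)) \<longlongrightarrow>
      l + (LINT y:B|lebesgue. g y)) (at_right 0)"
    using A by (intro tendsto_intros) (auto simp: has_pv_integral_def)
  moreover have "eventually (\<lambda>e. (LINT y:(A - ball x e)|lebesgue. g y) + (LINT y:B|lebesgue. g y)
      = (LINT y:(A \<union> B - ball x e)|lebesgue. g y)) (at_right 0)"
    using eventually_at_right_less[of 0] eventually_at_right_real[OF disj(3)]
  proof eventually_elim
    case (elim e)
    then have "A \<union> B - ball x e = (A - ball x e) \<union> B"
      using disj(2) subset_ball[of e r x] by auto
    then show ?case
      using disj(1) int[of e] B elim by (subst set_integral_Un[symmetric]) auto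
  qed
  ultimately have "((\<lambda>e. LINT y:(A \<union> B - ball x e)|lebesgue. g y) \<longlongrightarrow> l + (LINT y:B|lebesgue. g y)) (at_right 0)"
    by (rule Lim_transform_eventually)
  moreover have "set_integrable lebesgue (A \<union> B - ball x e) g" if "e > 0" for e
    unfolding Un_Diff
    by (rule absolutely_integrable_Un[OF int[OF that] intB])
  ultimately show ?thesis by (simp add: has_pv_integral_def)
qed

text \<open>The function \<open>k\<close> may fail to be integrable near \<open>x\<close>; it is
  enough that each of its truncated integrals vanishes. This removes the linear part of
  \<open>u\<close>.\<close>

lemma has_pv_integral_add_zero:
  fixes h k :: "real^'n::finite \<Rightarrow> real"
  assumes h: "has_pv_integral h l x S"
    and k: "\<And>e. e > 0 \<Longrightarrow> set_integrable lebesgue (S - ball x e) k"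
      "\<And>e. e > 0 \<Longrightarrow> (LINT y:(S - ball x e)|lebesgue. k y) = 0"
  shows "has_pv_integral (\<lambda>y. h y + k y) l x S"
proof -
  have int: "set_integrable lebesgue (S - ball x e) h" if "e > 0" for e
    using h that by (simp add: has_pv_integral_def)
  have "eventually (\<lambda>e. (LINT y:(S - ball x e)|lebesgue. h y)
      = (LINT y:(S - ball x e)|lebesgue. h y + k y)) (at_right 0)"
    using eventually_at_right_less[of 0]
    by eventually_elim (simp add: int k)
  moreover have "((\<lambda>e. LINT y:(S - ball x e)|lebesgue. h y) \<longlongrightarrow> l) (at_right 0)"
    using h by (simp add: has_pv_integral_def)
  ultimately have "((\<lambda>e. LINT y:(S - ball x e)|lebesgue. h y + k y) \<longlongrightarrow> l) (at_right 0)"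
    by (rule Lim_transform_eventually[rotated])
  then show ?thesis using int k by (auto simp: has_pv_integral_def)
qed

section \<open>Convergence near the singularity\<close>

lemma Holder_on_function:
  fixes u :: "real^'n::finite \<Rightarrow> real"
  assumes "Holder_on k \<beta> U u"
  shows "bounded (u ` U)"
    and "k = 0 \<Longrightarrow> \<exists>L. \<forall>x\<in>U. \<forall>y\<in>U. \<bar>u x - u y\<bar> \<le> L * dist x y powr \<beta>"
proof -
  have u: "mderiv (count_list []) u x = u x" if "x \<in> U" for x
    using Ck_on_mderiv_eq_pderivs[of k U u "[]" x] assms that by (simp add: Holder_on_def)
  have 0: "msize (count_list ([] :: 'n list)) = 0"
    unfolding msize_count_list by simp
  then have "bounded (mderiv (count_list []) u ` U)"
    using assms unfolding Holder_on_def by (metis zero_le)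
  then show "bounded (u ` U)"
    using u by (simp cong: image_cong)
  assume "k = 0"
  then obtain L where "\<forall>x\<in>U. \<forall>y\<in>U. \<bar>mderiv (count_list []) u x - mderiv (count_list []) u y\<bar> \<le> L * dist x y powr \<beta>"
    using assms 0 unfolding Holder_on_def by blast
  then show "\<exists>L. \<forall>x\<in>U. \<forall>y\<in>U. \<bar>u x - u y\<bar> \<le> L * dist x y powr \<beta>"
    using u by (intro exI[of _ L]) auto
qed

lemma C_class_bounded:
  assumes "u \<in> C_class \<theta>"
  obtains B where "\<And>y. y \<in> ball 0 4 \<Longrightarrow> \<bar>u y\<bar> \<le> B"
proof -
  have "bounded (u ` ball 0 4)"
    using assms Holder_on_function(1) unfolding C_class_def by (auto split: if_splits)
  then obtain B where "\<forall>y\<in>ball 0 4. \<bar>u y\<bar> \<le> B"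
    unfolding bounded_iff by auto
  then show thesis using that by blast
qed

text \<open>The bound is stated with the weight of \<open>kernel_class\<close>, so that it yields
  absolute convergence over B_3 directly.\<close>

lemma C_class_increment:
  fixes u :: "real^'n::finite \<Rightarrow> real"
  assumes u: "u \<in> C_class \<theta>" and \<theta>: "0 \<le> \<theta>" "\<theta> \<le> 1" and x: "x \<in> ball 0 1"
  obtains L where "\<And>y. y \<in> ball 0 3 \<Longrightarrow> \<bar>u x - u y\<bar> \<le> L * min (dist x y powr \<theta>) 1"
proof (cases "\<theta> = 0")
  case True
  obtain B where B: "\<And>y. y \<in> ball 0 4 \<Longrightarrow> \<bar>u y\<bar> \<le> B"
    by (rule C_class_bounded[OF u]) blast
  \<comment> \<open>For y = x both sides are 0, because \<open>0 powr 0 = 0\<close>; otherwise the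
    weight is 1.\<close>
  have "\<bar>u x - u y\<bar> \<le> (2 * B) * min (dist x y powr \<theta>) 1" if y: "y \<in> ball 0 3" for y
    using B[of x] B[of y] x y by (cases "x = y") (auto simp: True)
  then show thesis by (rule that)
next
  case False
  then have "Holder_on 0 \<theta> (ball 0 4) u"
    using u \<theta> by (auto simp: C_class_def)
  then obtain L where L: "\<And>y z. y \<in> ball 0 4 \<Longrightarrow> z \<in> ball 0 4 \<Longrightarrow> \<bar>u y - u z\<bar> \<le> L * dist y z powr \<theta>"
    using Holder_on_function(2) by blast
  have "\<bar>u x - u y\<bar> \<le> (4 * \<bar>L\<bar>) * min (dist x y powr \<theta>) 1" if y: "y \<in> ball 0 3" for y
  proof -
    have d: "dist x y \<le> 4"
      using dist_triangle[of x y 0] x y by (auto simp: dist_commute)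
    \<comment> \<open>Beyond distance 1 the exponent \<theta> \<le> 1 bounds the power by the
      distance itself, which is at most 4.\<close>
    have "dist x y powr \<theta> \<le> 4 * min (dist x y powr \<theta>) 1"
    proof (cases "dist x y \<le> 1")
      case True
      then have "dist x y powr \<theta> \<le> 1"
        using \<theta> powr_le1 by auto
      then show ?thesis using powr_ge_zero[of "dist x y" \<theta>] by simp
    next
      case False
      then have "dist x y powr \<theta> \<le> dist x y powr 1" "1 \<le> dist x y powr \<theta>"
        using \<theta> powr_mono[of \<theta> 1 "dist x y"] ge_one_powr_ge_zero[of "dist x y" \<theta>] by simp_all
      then show ?thesis using d False by simp
    qed
    then have "L * dist x y powr \<theta> \<le> \<bar>L\<bar> * (4 * min (dist x y powr \<theta>) 1)"
      by (intro mult_mono) auto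
    then show ?thesis
      using L[of x y] x y by simp
  qed
  then show thesis by (rule that)
qed

text \<open>Along the segment the derivative of the remainder is the increment of the gradient
  applied to \<open>y - x\<close>: Hoelder continuity gives the power \<theta> - 1, and the factor
  \<open>y - x\<close> supplies the missing power 1.\<close>

lemma C_class_first_order_remainder:
  fixes u :: "real^'n::finite \<Rightarrow> real"
  assumes u: "u \<in> C_class \<theta>" and \<theta>: "1 < \<theta>" and x: "x \<in> ball 0 1"
  obtains L where "\<And>y. y \<in> ball x 1 \<Longrightarrow>
    \<bar>u x - u y + (\<Sum>i\<in>UNIV. (y - x) $ i * pderiv_at i u x)\<bar> \<le> L * dist x y powr \<theta>"
proof -
  have H: "Holder_on 1 (\<theta> - 1) (ball 0 4) u"
    using u \<theta> by (auto simp: C_class_def)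
  then have C1: "Ck_on 1 (ball 0 4) u" by (simp add: Holder_on_def)
  have D: "pdiff_at i u y" if "y \<in> ball 0 4" for i y
    using Ck_on_pderivs_exist[OF C1, of "[i]"] that by simp
  have cont: "continuous_on (ball 0 4) (pderiv_at i u)" for i
    using Ck_on_continuous_pderivs[OF C1, of "[i]"] by simp
  have "\<exists>L. \<forall>y\<in>ball 0 4. \<forall>z\<in>ball 0 4. \<bar>pderiv_at i u y - pderiv_at i u z\<bar> \<le> L * dist y z powr (\<theta> - 1)" for i
  proof -
    have eq: "mderiv (count_list [i]) u y = pderiv_at i u y" if "y \<in> ball 0 4" for y
      using Ck_on_mderiv_eq_pderivs[OF C1, of "[i]" y] that by simp
    have "msize (count_list [i]) = 1" by (simp only: msize_count_list) simp
    then obtain L where "\<forall>y\<in>ball 0 4. \<forall>z\<in>ball 0 4.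
        \<bar>mderiv (count_list [i]) u y - mderiv (count_list [i]) u z\<bar> \<le> L * dist y z powr (\<theta> - 1)"
      using H unfolding Holder_on_def by blast
    then show ?thesis
      by (intro exI[of _ L]) (metis eq)
  qed
  then obtain L where L: "\<And>i y z. y \<in> ball 0 4 \<Longrightarrow> z \<in> ball 0 4 \<Longrightarrow>
      \<bar>pderiv_at i u y - pderiv_at i u z\<bar> \<le> L i * dist y z powr (\<theta> - 1)"
    by metis
  have "\<bar>u x - u y + (\<Sum>i\<in>UNIV. (y - x) $ i * pderiv_at i u x)\<bar> \<le> (\<Sum>i\<in>UNIV. \<bar>L i\<bar>) * dist x y powr \<theta>"
    if y: "y \<in> ball x 1" for y
  proof -
    define v where "v = y - x"
    have v: "norm v < 1" "norm v = dist x y"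
      using y by (auto simp: v_def dist_norm norm_minus_commute)
    have inb: "x + t *\<^sub>R v \<in> ball 0 4" if "t \<in> {0..1}" for t
    proof -
      have "norm (t *\<^sub>R v) \<le> norm v"
        using that by (simp add: mult_left_le_one_le)
      then show ?thesis
        using norm_triangle_ineq[of x "t *\<^sub>R v"] v x by simp
    qed
    define \<phi> where "\<phi> t = u (x + t *\<^sub>R v) - t * (\<Sum>i\<in>UNIV. v $ i * pderiv_at i u x)" for t
    have "norm (\<phi> 1 - \<phi> 0) \<le> ((\<Sum>i\<in>UNIV. \<bar>L i\<bar>) * dist x y powr \<theta>) * norm (1 - 0 :: real)"
    proof (rule field_differentiable_bound)
      fix t :: real assume t: "t \<in> {0..1}"
      show "(\<phi> has_field_derivative ((\<Sum>i\<in>UNIV. v $ i * pderiv_at i u (x + t *\<^sub>R v)) -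
          (\<Sum>i\<in>UNIV. v $ i * pderiv_at i u x))) (at t within {0..1})"
        unfolding \<phi>_def
        by (rule has_field_derivative_at_within)
           (auto intro!: derivative_eq_intros DERIV_line[OF open_ball inb[OF t] D cont])
      have "norm ((\<Sum>i\<in>UNIV. v $ i * pderiv_at i u (x + t *\<^sub>R v)) - (\<Sum>i\<in>UNIV. v $ i * pderiv_at i u x))
          \<le> (\<Sum>i\<in>UNIV. \<bar>v $ i * (pderiv_at i u (x + t *\<^sub>R v) - pderiv_at i u x)\<bar>)"
        unfolding sum_subtractf[symmetric] right_diff_distrib[symmetric] real_norm_def by (rule sum_abs)
      also have "\<dots> \<le> (\<Sum>i\<in>UNIV. \<bar>L i\<bar> * dist x y powr \<theta>)"
      proof (rule sum_mono)
        fix i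
        have "dist (x + t *\<^sub>R v) x \<le> dist x y"
          using t v by (simp add: dist_norm mult_left_le_one_le)
        then have p: "dist (x + t *\<^sub>R v) x powr (\<theta> - 1) \<le> dist x y powr (\<theta> - 1)"
          using \<theta> by (intro powr_mono2) auto
        have "\<bar>pderiv_at i u (x + t *\<^sub>R v) - pderiv_at i u x\<bar> \<le> L i * dist (x + t *\<^sub>R v) x powr (\<theta> - 1)"
          using L inb[OF t] x by simp
        also have "\<dots> \<le> \<bar>L i\<bar> * dist x y powr (\<theta> - 1)"
          using p by (intro mult_mono) auto
        finally have "\<bar>v $ i * (pderiv_at i u (x + t *\<^sub>R v) - pderiv_at i u x)\<bar>
            \<le> dist x y * (\<bar>L i\<bar> * dist x y powr (\<theta> - 1))"
          unfolding abs_mult using component_le_norm_cart[of v i] v by (intro mult_mono) auto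
        also have "\<dots> = \<bar>L i\<bar> * dist x y powr \<theta>"
          using powr_mult_base[of "dist x y" "\<theta> - 1"] by (simp add: mult_ac)
        finally show "\<bar>v $ i * (pderiv_at i u (x + t *\<^sub>R v) - pderiv_at i u x)\<bar> \<le> \<bar>L i\<bar> * dist x y powr \<theta>" .
      qed
      finally show "norm ((\<Sum>i\<in>UNIV. v $ i * pderiv_at i u (x + t *\<^sub>R v)) - (\<Sum>i\<in>UNIV. v $ i * pderiv_at i u x))
          \<le> (\<Sum>i\<in>UNIV. \<bar>L i\<bar>) * dist x y powr \<theta>"
        by (simp add: sum_distrib_right)
    qed auto
    moreover have "\<phi> 1 - \<phi> 0 = - (u x - u y + (\<Sum>i\<in>UNIV. (y - x) $ i * pderiv_at i u x))"
      by (simp add: \<phi>_def v_def)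
    ultimately show ?thesis by simp
  qed
  then show thesis by (rule that)
qed

lemma kernel_set_integrable:
  fixes K :: "real^'n::finite \<Rightarrow> real^'n \<Rightarrow> real"
  assumes K: "K \<in> kernel_class m \<theta>" and x: "x \<in> ball 0 1" and S: "S \<in> sets lebesgue"
    and b: "b \<in> borel_measurable lebesgue"
    and le: "\<And>y. y \<in> S \<Longrightarrow> \<bar>b y\<bar> \<le> L * min (dist x y powr \<theta>) 1"
  shows "set_integrable lebesgue S (\<lambda>y. b y * K x y)"
proof -
  have Kx: "K x \<in> borel_measurable lebesgue"
    using K x by (simp add: kernel_class_def)
  have "continuous_on UNIV (\<lambda>y. dist x y)"
    by (intro continuous_intros)
  then have "(\<lambda>y. dist x y) \<in> borel_measurable lebesgue"
    by (intro measurable_completion) (simp add: borel_measurable_continuous_onI)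
  then have w: "(\<lambda>y. min (dist x y powr \<theta>) 1 * \<bar>K x y\<bar>) \<in> borel_measurable lebesgue"
    using Kx by measurable
  have "integrable lebesgue (\<lambda>y. min (dist x y powr \<theta>) 1 * \<bar>K x y\<bar>)"
    using w K x by (intro integrableI_nonneg) (auto simp: kernel_class_def)
  then have "integrable lebesgue (\<lambda>y. L * (min (dist x y powr \<theta>) 1 * \<bar>K x y\<bar>))"
    by simp
  then show ?thesis
    unfolding set_integrable_def
  proof (rule Bochner_Integration.integrable_bound)
    show "(\<lambda>y. indicat_real S y *\<^sub>R (b y * K x y)) \<in> borel_measurable lebesgue"
      using S b Kx by measurable
    show "AE y in lebesgue. norm (indicat_real S y *\<^sub>R (b y * K x y))
        \<le> norm (L * (min (dist x y powr \<theta>) 1 * \<bar>K x y\<bar>))"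
    proof (rule AE_I2)
      fix y
      show "norm (indicat_real S y *\<^sub>R (b y * K x y)) \<le> norm (L * (min (dist x y powr \<theta>) 1 * \<bar>K x y\<bar>))"
      proof (cases "y \<in> S")
        case True
        have "\<bar>b y\<bar> * \<bar>K x y\<bar> \<le> L * min (dist x y powr \<theta>) 1 * \<bar>K x y\<bar>"
          using le[OF True] by (intro mult_right_mono) auto
        also have "\<dots> \<le> \<bar>L * min (dist x y powr \<theta>) 1 * \<bar>K x y\<bar>\<bar>"
          by (rule abs_ge_self)
        finally show ?thesis
          using True by (simp add: abs_mult mult.assoc)
      qed simp
    qed
  qed
qed

text \<open>At distance at least \<open>e\<close> from \<open>x\<close> the weight is bounded below
  by \<open>min (e powr \<theta>) 1\<close>, so boundedness of \<open>b\<close> suffices.\<close>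

lemma kernel_set_integrable_away:
  fixes K :: "real^'n::finite \<Rightarrow> real^'n \<Rightarrow> real"
  assumes K: "K \<in> kernel_class m \<theta>" and x: "x \<in> ball 0 1" and S: "S \<in> sets lebesgue"
    and b: "b \<in> borel_measurable lebesgue" "\<And>y. y \<in> S \<Longrightarrow> \<bar>b y\<bar> \<le> B"
    and away: "S \<inter> ball x e = {}" "e > 0" and \<theta>: "0 \<le> \<theta>"
  shows "set_integrable lebesgue S (\<lambda>y. b y * K x y)"
proof (rule kernel_set_integrable[OF K x S b(1)])
  fix y assume y: "y \<in> S"
  then have "e \<le> dist x y" using away by (auto simp: not_less[symmetric])
  then have "min (e powr \<theta>) 1 \<le> min (dist x y powr \<theta>) 1"
    using away \<theta> by (intro min.mono powr_mono2) auto
  moreover have pos: "min (e powr \<theta>) 1 > 0" using away by simp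
  moreover have "\<bar>B\<bar> / min (e powr \<theta>) 1 \<ge> 0" using pos by (intro divide_nonneg_pos) auto
  ultimately have "\<bar>B\<bar> / min (e powr \<theta>) 1 * min (e powr \<theta>) 1 \<le> \<bar>B\<bar> / min (e powr \<theta>) 1 * min (dist x y powr \<theta>) 1"
    by (intro mult_left_mono)
  then show "\<bar>b y\<bar> \<le> \<bar>B\<bar> / min (e powr \<theta>) 1 * min (dist x y powr \<theta>) 1"
    using b(2)[OF y] pos by simp
qed

lemma pv_integrable_ball:
  fixes K :: "real^'n::finite \<Rightarrow> real^'n \<Rightarrow> real"
  assumes K: "K \<in> kernel_class m \<theta>" and u: "u \<in> C_class \<theta>" and \<theta>: "0 \<le> \<theta>"
    and x: "x \<in> ball 0 1"
  shows "\<exists>l. has_pv_integral (\<lambda>y. (u x - u y) * K x y) l x (ball 0 3)"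
proof -
  have um[measurable]: "u \<in> borel_measurable lebesgue"
    using u by (simp add: C_class_def L1_loc_def)
  show ?thesis
  proof (cases "\<theta> \<le> 1")
    case True
    obtain L where "\<And>y. y \<in> ball 0 3 \<Longrightarrow> \<bar>u x - u y\<bar> \<le> L * min (dist x y powr \<theta>) 1"
      by (rule C_class_increment[OF u \<theta> True x]) blast
    then have "set_integrable lebesgue (ball 0 3) (\<lambda>y. (u x - u y) * K x y)"
      by (intro kernel_set_integrable[OF K x, where L = L]) auto
    from has_pv_integral_set_integrable[OF this, of x] show ?thesis by auto
  next
    case False
    then have \<theta>1: "1 < \<theta>" by simp
    define d where "d y = (\<Sum>i\<in>UNIV. (y - x) $ i * pderiv_at i u x)" for y
    obtain L where L: "\<And>y. y \<in> ball x 1 \<Longrightarrow> \<bar>u x - u y + d y\<bar> \<le> L * dist x y powr \<theta>"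
      unfolding d_def by (rule C_class_first_order_remainder[OF u \<theta>1 x]) blast
    have dcont: "continuous_on UNIV d"
      unfolding d_def by (intro continuous_intros)
    then have dm[measurable]: "d \<in> borel_measurable lebesgue"
      by (intro measurable_completion) (simp add: borel_measurable_continuous_onI)
    have dbound: "\<exists>B. \<forall>y\<in>ball x 1. \<bar>d y\<bar> \<le> B"
    proof -
      have "compact (d ` cball x 1)"
        by (rule compact_continuous_image[OF continuous_on_subset[OF dcont]]) auto
      then obtain B where "\<forall>y\<in>cball x 1. \<bar>d y\<bar> \<le> B"
        using compact_imp_bounded[of "d ` cball x 1"] by (auto simp: bounded_iff)
      then show ?thesis by (intro exI[of _ B]) auto
    qed
    \<comment> \<open>Radius 1 is the range in which the symmetry of \<open>K x\<close> about
      \<open>x\<close> is assumed. The rest of B_3 keeps distance 1 from \<open>x\<close>, where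
      bounded factors suffice.\<close>
    have "set_integrable lebesgue (ball x 1) (\<lambda>y. (u x - u y + d y) * K x y)"
    proof (rule kernel_set_integrable[OF K x, where L = L])
      fix y assume y: "y \<in> ball x 1"
      then have "dist x y powr \<theta> \<le> 1" using \<theta> by (intro powr_le1) auto
      then show "\<bar>u x - u y + d y\<bar> \<le> L * min (dist x y powr \<theta>) 1"
        using L[OF y] by (simp add: min_def)
    qed auto
    from has_pv_integral_set_integrable[OF this]
    have h: "has_pv_integral (\<lambda>y. (u x - u y + d y) * K x y)
        (LINT y:ball x 1|lebesgue. (u x - u y + d y) * K x y) x (ball x 1)" (is "has_pv_integral _ ?l _ _")
      by simp
    \<comment> \<open>Near \<open>x\<close> the linear part has size of order
      \<open>dist x y\<close>, which the weight with exponent \<theta> > 1 does not control; hence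
      integrability is claimed off each ball only, and cancellation does the rest.\<close>
    have k: "set_integrable lebesgue (ball x 1 - ball x e) (\<lambda>y. - d y * K x y)" if "e > 0" for e
    proof -
      obtain B where "\<forall>y\<in>ball x 1. \<bar>d y\<bar> \<le> B" using dbound by blast
      then show ?thesis
        using that \<theta> by (intro kernel_set_integrable_away[OF K x, where B = B and e = e]) auto
    qed
    have odd: "(LINT y:(ball x 1 - ball x e)|lebesgue. - d y * K x y) = 0" if e: "e > 0" for e
    proof (rule set_integral_odd[OF k[OF e], where c = "2 *\<^sub>R x"], intro conjI)
      fix y assume y: "y \<in> ball x 1 - ball x e"
      have "dist x (2 *\<^sub>R x - y) = dist x y"
        by (simp add: dist_norm scaleR_2 norm_minus_commute)
      then show "2 *\<^sub>R x - y \<in> ball x 1 - ball x e" using y by simp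
      have "y - x \<in> ball 0 1" using y by (simp add: dist_norm norm_minus_commute)
      then have "K x (x + (y - x)) = K x (x - (y - x))"
        using K x \<theta>1 unfolding kernel_class_def by blast
      then have "K x (2 *\<^sub>R x - y) = K x y" by (simp add: scaleR_2 algebra_simps)
      moreover have "d (2 *\<^sub>R x - y) = - d y"
        unfolding d_def sum_negf[symmetric] by (intro sum.cong) (auto simp: algebra_simps)
      ultimately show "- d (2 *\<^sub>R x - y) * K x (2 *\<^sub>R x - y) = - (- d y * K x y)" by simp
    qed
    have "has_pv_integral (\<lambda>y. (u x - u y) * K x y) ?l x (ball x 1)"
      using has_pv_integral_add_zero[OF h k odd] by (simp add: algebra_simps)
    moreover obtain B where B: "\<And>y. y \<in> ball 0 4 \<Longrightarrow> \<bar>u y\<bar> \<le> B"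
      by (rule C_class_bounded[OF u]) blast
    have "set_integrable lebesgue (ball 0 3 - ball x 1) (\<lambda>y. (u x - u y) * K x y)"
    proof (rule kernel_set_integrable_away[OF K x, where B = "2 * B" and e = 1])
      show "\<bar>u x - u y\<bar> \<le> 2 * B" if "y \<in> ball 0 3 - ball x 1" for y
        using B[of x] B[of y] x that by simp
    qed (use \<theta> in auto)
    ultimately have "has_pv_integral (\<lambda>y. (u x - u y) * K x y)
        (?l + (LINT y:(ball 0 3 - ball x 1)|lebesgue. (u x - u y) * K x y)) x (ball x 1 \<union> (ball 0 3 - ball x 1))"
      by (intro has_pv_integral_Un[where r = 1]) auto
    moreover have "ball x 1 \<subseteq> ball 0 3"
    proof
      fix y assume "y \<in> ball x 1"
      then show "y \<in> ball 0 3"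
        using dist_triangle[of 0 y x] x by simp
    qed
    then have "ball x 1 \<union> (ball 0 3 - ball x 1) = ball 0 3" by blast
    ultimately show ?thesis by auto
  qed
qed

section \<open>Measurability and integrability of the remainder\<close>

lemma borel_measurable_word_sum:
  assumes "\<And>w. length w = k \<Longrightarrow> (\<lambda>z. c z w) \<in> borel_measurable M"
    and "\<And>i. (\<lambda>z. X z $ i) \<in> borel_measurable M"
  shows "(\<lambda>z. word_sum k (c z) (X z)) \<in> borel_measurable M"
  using assms(1)
proof (induction k arbitrary: c)
  case (Suc k)
  have "(\<lambda>z. word_sum k (\<lambda>w. c z (i # w)) (X z)) \<in> borel_measurable M" for i
    by (rule Suc.IH) (simp add: Suc.prems)
  then show ?case
    using assms(2) by (auto intro!: borel_measurable_sum borel_measurable_times)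
qed simp

lemma has_bochner_integral_word_sum:
  assumes "\<And>w. length w = k \<Longrightarrow> has_bochner_integral M (c w) (I w)"
  shows "has_bochner_integral M (\<lambda>z. word_sum k (\<lambda>w. c w z) x) (word_sum k I x)"
  using assms
proof (induction k arbitrary: c I)
  case (Suc k)
  have "has_bochner_integral M (\<lambda>z. word_sum k (\<lambda>w. c (i # w) z) x) (word_sum k (\<lambda>w. I (i # w)) x)" for i
    by (rule Suc.IH) (simp add: Suc.prems)
  then show ?case
    by (auto intro!: has_bochner_integral_sum has_bochner_integral_mult_right)
qed simp

lemma word_sum_scale: "word_sum k (\<lambda>w. a * c w) x = a * word_sum k c x"
  using word_sum_sum_scale[of k "\<lambda>_. a" "\<lambda>_. c" "{()}" x] by simp

text \<open>Each further derivative is a pointwise limit of difference quotients of slices that are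
  measurable by induction. The start of the induction is the measurability of every slice of
  \<open>K\<close> over the unit ball.\<close>

lemma kernel_pderivs_measurable:
  fixes K :: "real^'n::finite \<Rightarrow> real^'n \<Rightarrow> real"
  assumes K: "K \<in> kernel_class m \<theta>" and w: "length w \<le> m" and x: "x \<in> ball 0 1"
  shows "(\<lambda>y. pderivs w (\<lambda>x. K x y) x) \<in> borel_measurable (lebesgue_on (- ball 0 3))"
  using w x
proof (induction w arbitrary: x)
  case Nil
  then show ?case
    using K by (auto simp: kernel_class_def intro: measurable_restrict_space1)
next
  case (Cons i w)
  define G where "G x y = pderivs w (\<lambda>x. K x y) x" for x y
  obtain r where r: "r > 0" "ball x r \<subseteq> ball 0 1"
    using Cons.prems(2) openE[OF open_ball] by blast
  \<comment> \<open>The denominator starts at 2 so that each step is strictly below \<open>r\<close>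
    and the shifted point stays in the open ball.\<close>
  define t where "t n = r / real (Suc (Suc n))" for n
  have t: "t n > 0" "t n < r" for n
    using r by (auto simp: t_def divide_less_eq)
  have t0: "t \<longlonglongrightarrow> 0"
    unfolding t_def using LIMSEQ_Suc[OF LIMSEQ_Suc[OF lim_const_over_n[of r]]] by simp
  show ?case
  proof (rule borel_measurable_LIMSEQ_real)
    fix n
    have "x + t n *\<^sub>R axis i 1 \<in> ball x r"
      using t[of n] by (simp add: dist_norm)
    then show "(\<lambda>y. (G (x + t n *\<^sub>R axis i 1) y - G x y) / t n) \<in> borel_measurable (lebesgue_on (- ball 0 3))"
      unfolding G_def using r(2) Cons.prems
      by (intro borel_measurable_divide borel_measurable_diff Cons.IH borel_measurable_const) auto
  next
    fix y :: "real^'n" assume "y \<in> space (lebesgue_on (- ball 0 3))"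
    then have "Ck_on m (ball 0 1) (\<lambda>x. K x y)"
      using K by (simp add: kernel_class_def)
    from Ck_on_pderivs_exist[OF this Cons.prems(1)] have "pdiff_at i (\<lambda>x. G x y) x"
      using Cons.prems(2) by (simp add: G_def[abs_def])
    then have "((\<lambda>h. (G (x + h *\<^sub>R axis i 1) y - G x y) / h) \<longlongrightarrow> pderiv_at i (\<lambda>x. G x y) x) (at 0)"
      by (simp add: pdiff_at_iff DERIV_def)
    moreover have "filterlim t (at 0) sequentially"
      using t0 t(1) by (auto simp: filterlim_at intro!: always_eventually less_imp_neq[symmetric])
    ultimately have "(\<lambda>n. (G (x + t n *\<^sub>R axis i 1) y - G x y) / t n) \<longlonglongrightarrow> pderiv_at i (\<lambda>x. G x y) x"
      by (rule filterlim_compose)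
    then show "(\<lambda>n. (G (x + t n *\<^sub>R axis i 1) y - G x y) / t n) \<longlonglongrightarrow> pderivs (i # w) (\<lambda>x. K x y) x"
      by (simp add: G_def[abs_def])
  qed
qed

text \<open>The Taylor coefficients are taken at the fixed point 0 and depend on \<open>y\<close>
  alone, so joint measurability is needed only of \<open>K\<close> itself and of the coordinates of
  \<open>x\<close>.\<close>

lemma taylor_defect_kernel_measurable:
  fixes K :: "real^'n::finite \<Rightarrow> real^'n \<Rightarrow> real"
  assumes K: "K \<in> kernel_class m \<theta>"
  shows "(\<lambda>(x, y). taylor_defect m (\<lambda>x. K x y) x) \<in>
    borel_measurable (lebesgue_on (ball 0 1 \<times> - ball 0 3))" (is "_ \<in> borel_measurable ?M")
proof -
  have fst: "fst \<in> ?M \<rightarrow>\<^sub>M lebesgue"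
    by (rule measurable_restrict_space1[OF measurable_fst_lebesgue])
  have snd: "snd \<in> ?M \<rightarrow>\<^sub>M lebesgue_on (- ball 0 3)"
    by (rule measurable_restrict_space3[OF measurable_snd_lebesgue]) auto
  have "(\<lambda>z. fst z $ i) \<in> borel_measurable ?M" for i
  proof -
    have "(\<lambda>x :: real^'n. x $ i) \<in> borel_measurable lebesgue"
      by (intro measurable_completion) (simp add: borel_measurable_continuous_onI continuous_on_component continuous_on_id)
    then show ?thesis by (rule measurable_compose[OF fst])
  qed
  moreover have "(\<lambda>z. pderivs w (\<lambda>x. K x (snd z)) 0) \<in> borel_measurable ?M" if "length w \<le> m" for w
    by (rule measurable_compose[OF snd kernel_pderivs_measurable[OF K that]]) simp
  moreover have "(\<lambda>z. K (fst z) (snd z)) \<in> borel_measurable ?M"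
    using K by (auto simp: kernel_class_def case_prod_beta' intro: measurable_restrict_space1)
  ultimately have "(\<lambda>z. taylor_defect m (\<lambda>x. K x (snd z)) (fst z)) \<in> borel_measurable ?M"
    unfolding taylor_defect_def
    by (intro borel_measurable_diff borel_measurable_sum borel_measurable_divide
        borel_measurable_word_sum borel_measurable_const) auto
  then show ?thesis by (simp add: case_prod_beta')
qed

lemma taylor_defect_kernel_measurable_section:
  fixes K :: "real^'n::finite \<Rightarrow> real^'n \<Rightarrow> real"
  assumes K: "K \<in> kernel_class m \<theta>" and x: "x \<in> ball 0 1"
  shows "(\<lambda>y. taylor_defect m (\<lambda>x. K x y) x) \<in> borel_measurable (lebesgue_on (- ball 0 3))"
proof -
  have "(\<lambda>y. K x y) \<in> borel_measurable (lebesgue_on (- ball 0 3))"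
    using kernel_pderivs_measurable[OF K _ x, of "[]"] by simp
  then show ?thesis
    unfolding taylor_defect_def
    by (intro borel_measurable_diff borel_measurable_sum borel_measurable_divide
        borel_measurable_word_sum borel_measurable_const kernel_pderivs_measurable[OF K]) auto
qed

lemma set_integrable_bound_nn_integral:
  fixes h :: "'a::euclidean_space \<Rightarrow> real"
  assumes h: "h \<in> borel_measurable (lebesgue_on S)" and S: "S \<in> sets lebesgue"
    and le: "\<And>y. y \<in> S \<Longrightarrow> ennreal \<bar>h y\<bar> \<le> ennreal C * F y"
    and F: "(\<integral>\<^sup>+y\<in>S. F y \<partial>lebesgue) < \<infinity>" and C: "C > 0"
  shows "set_integrable lebesgue S h"
proof -
  have m: "(\<lambda>y. indicator S y *\<^sub>R h y) \<in> borel_measurable lebesgue"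
    using h S by (simp add: borel_measurable_restrict_space_iff)
  \<comment> \<open>The bound \<open>F\<close> need not be measurable, so the constant is moved to the measurable side.\<close>
  have "(\<integral>\<^sup>+y. ennreal (norm (indicator S y *\<^sub>R h y / C)) \<partial>lebesgue) \<le> (\<integral>\<^sup>+y\<in>S. F y \<partial>lebesgue)"
  proof (rule nn_integral_mono)
    fix y
    show "ennreal (norm (indicator S y *\<^sub>R h y / C)) \<le> F y * indicator S y"
    proof (cases "y \<in> S")
      case True
      have "ennreal (\<bar>h y\<bar> / C) = ennreal (1 / C) * ennreal \<bar>h y\<bar>"
        using C by (simp add: ennreal_mult[symmetric])
      also have "\<dots> \<le> ennreal (1 / C) * (ennreal C * F y)"
        by (intro mult_left_mono le True) simp
      also have "\<dots> = F y"
        using C by (simp add: mult.assoc[symmetric] ennreal_mult[symmetric])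
      finally show ?thesis
        using True C by simp
    qed simp
  qed
  then have "integrable lebesgue (\<lambda>y. indicator S y *\<^sub>R h y / C)"
    using m F by (intro integrableI_bounded) (auto intro: le_less_trans)
  then have "integrable lebesgue (\<lambda>y. C * (indicator S y *\<^sub>R h y / C))"
    by (rule integrable_mult_right)
  then show ?thesis
    using C by (simp add: set_integrable_def)
qed

text \<open>For \<gamma> = 0 the supremum in the derivative bound runs over multi-indices of size
  exactly \<open>m\<close>, which is the weight against which \<open>u\<close> is integrable by
  \<open>C_class_K\<close>; the cutoff only decreases the integrand.\<close>

lemma taylor_defect_kernel_integrable:
  fixes K :: "real^'n::finite \<Rightarrow> real^'n \<Rightarrow> real"
  assumes K: "K \<in> kernel_class m \<theta>" and u: "u \<in> C_class_K m \<theta> K" and \<tau>: "cutoff \<tau>"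
    and x: "x \<in> ball 0 1"
  shows "set_integrable lebesgue (- ball 0 3) (\<lambda>y. \<tau> y * u y * taylor_defect m (\<lambda>x. K x y) x)"
proof (rule set_integrable_bound_nn_integral)
  let ?S = "\<lambda>y. SUP \<alpha>\<in>{\<alpha>. msize \<alpha> = m}. sup_mderiv (ball 0 1) \<alpha> (\<lambda>x. K x y)"
  have "u \<in> borel_measurable lebesgue" "\<tau> \<in> borel_measurable lebesgue"
    using u \<tau> by (auto simp: C_class_K_def C_class_def L1_loc_def cutoff_def)
  then show "(\<lambda>y. \<tau> y * u y * taylor_defect m (\<lambda>x. K x y) x) \<in> borel_measurable (lebesgue_on (- ball 0 3))"
    by (intro borel_measurable_times taylor_defect_kernel_measurable_section[OF K x] measurable_restrict_space1)
  show "(\<integral>\<^sup>+y\<in>- ball 0 3. (ennreal \<bar>u y\<bar> * ?S y) \<partial>lebesgue) < \<infinity>"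
    using u by (simp add: C_class_K_def)
  fix y :: "real^'n" assume y: "y \<in> - ball 0 3"
  define \<psi> where "\<psi> = taylor_defect m (\<lambda>x. K x y)"
  have g: "Ck_on m (ball 0 1) (\<lambda>x. K x y)"
    using K y by (simp add: kernel_class_def)
  have size: "msize (count_list ([] :: 'n list)) = 0"
    unfolding msize_count_list by simp
  have ex: "mderiv_exists (ball 0 1) (count_list []) \<psi>"
  proof -
    have "orderings (count_list ([] :: 'n list)) = {[]}"
      by (simp add: set_eq_iff orderings_iff count_list_eq_iff_mset)
    then show ?thesis by (simp add: mderiv_exists_def)
  qed
  have "mderiv (count_list []) \<psi> x = \<psi> x"
    using mderiv_eq_pderivs[OF ex, of "[]" x] x by (simp add: orderings_iff)
  then have "ennreal \<bar>\<psi> x\<bar> \<le> (SUP x\<in>ball 0 1. ennreal \<bar>mderiv (count_list []) \<psi> x\<bar>)"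
    using SUP_upper[OF x, of "\<lambda>x. ennreal \<bar>mderiv (count_list []) \<psi> x\<bar>"] by simp
  also have "\<dots> = sup_mderiv (ball 0 1) (count_list []) \<psi>"
    using ex by (simp add: sup_mderiv_def)
  also have "\<dots> \<le> ennreal (real CARD('n) ^ m) * ?S y"
  proof -
    have "{\<eta> :: 'n \<Rightarrow> nat. m \<le> msize \<eta> \<and> msize \<eta> \<le> m + 0} = {\<alpha>. msize \<alpha> = m}"
      by auto
    with sup_mderiv_taylor_defect[OF g, of "count_list []", unfolded size] show ?thesis
      unfolding \<psi>_def by (simp only:)
  qed
  finally have *: "ennreal \<bar>\<psi> x\<bar> \<le> ennreal (real CARD('n) ^ m) * ?S y" .
  have "\<bar>\<tau> y * u y * \<psi> x\<bar> \<le> \<bar>u y\<bar> * \<bar>\<psi> x\<bar>"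
    using \<tau> by (auto simp: cutoff_def abs_mult intro!: mult_right_mono mult_left_le_one_le)
  then have "ennreal \<bar>\<tau> y * u y * \<psi> x\<bar> \<le> ennreal \<bar>u y\<bar> * ennreal \<bar>\<psi> x\<bar>"
    by (simp add: ennreal_mult[symmetric])
  also have "\<dots> \<le> ennreal \<bar>u y\<bar> * (ennreal (real CARD('n) ^ m) * ?S y)"
    by (rule mult_left_mono[OF *]) simp
  finally show "ennreal \<bar>\<tau> y * u y * taylor_defect m (\<lambda>x. K x y) x\<bar>
      \<le> ennreal (real CARD('n) ^ m) * (ennreal \<bar>u y\<bar> * ?S y)"
    by (simp add: \<psi>_def mult_ac)
qed auto

text \<open>These integrals become the coefficients of the polynomial. Orders below \<open>m\<close>
  are controlled on bounded shells only, and this is where the compact support of \<tau>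
  enters.\<close>

lemma kernel_derivative_moment_integrable:
  fixes K :: "real^'n::finite \<Rightarrow> real^'n \<Rightarrow> real"
  assumes K: "K \<in> kernel_class m \<theta>" and u: "u \<in> C_class_K m \<theta> K" and \<tau>: "cutoff \<tau>"
    and w: "length w < m"
  shows "set_integrable lebesgue (- ball 0 3) (\<lambda>y. \<tau> y * u y * pderivs w (\<lambda>x. K x y) 0)"
proof -
  have "bounded (closure {x. \<tau> x \<noteq> 0})"
    using \<tau> by (auto simp: cutoff_def intro: compact_imp_bounded)
  then obtain R where "\<forall>y\<in>closure {x. \<tau> x \<noteq> 0}. norm y \<le> R"
    unfolding bounded_iff by (elim exE)
  then have R: "norm y \<le> R" if "\<tau> y \<noteq> 0" for y
    using that subsetD[OF closure_subset, of y "{x. \<tau> x \<noteq> 0}"] by simp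
  \<comment> \<open>The radius must exceed 3 to be admissible in \<open>C_class_K\<close> and exceed
    \<open>R\<close> so that the open ball contains the support.\<close>
  define R' where "R' = max R 3 + 1"
  let ?A = "ball 0 R' - ball (0 :: real^'n) 3"
  let ?F = "\<lambda>\<alpha> y. ennreal (\<bar>u y\<bar> * \<bar>mderiv \<alpha> (\<lambda>x. K x y) 0\<bar>)"
  have "(\<Sum>\<alpha> | msize \<alpha> < m. \<integral>\<^sup>+y\<in>?A. ?F \<alpha> y \<partial>lebesgue) < \<infinity>"
    using u unfolding C_class_K_def by (auto simp: R'_def)
  moreover have "(\<integral>\<^sup>+y\<in>?A. ?F (count_list w) y \<partial>lebesgue) \<le> (\<Sum>\<alpha> | msize \<alpha> < m. \<integral>\<^sup>+y\<in>?A. ?F \<alpha> y \<partial>lebesgue)"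
    using w by (intro member_le_sum) (auto simp: finite_msize_less msize_count_list)
  ultimately have fin: "(\<integral>\<^sup>+y\<in>?A. ?F (count_list w) y \<partial>lebesgue) < \<infinity>"
    by (rule le_less_trans[rotated])
  show ?thesis
  proof (rule set_integrable_bound_nn_integral[where C = 1])
    have "u \<in> borel_measurable lebesgue" "\<tau> \<in> borel_measurable lebesgue"
      using u \<tau> by (auto simp: C_class_K_def C_class_def L1_loc_def cutoff_def)
    then show "(\<lambda>y. \<tau> y * u y * pderivs w (\<lambda>x. K x y) 0) \<in> borel_measurable (lebesgue_on (- ball 0 3))"
      using w by (intro borel_measurable_times kernel_pderivs_measurable[OF K] measurable_restrict_space1) auto
    have "(\<integral>\<^sup>+y\<in>- ball 0 3. (?F (count_list w) y * indicator ?A y) \<partial>lebesgue) = (\<integral>\<^sup>+y\<in>?A. ?F (count_list w) y \<partial>lebesgue)"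
      by (intro nn_integral_cong) (auto simp: indicator_def)
    then show "(\<integral>\<^sup>+y\<in>- ball 0 3. (?F (count_list w) y * indicator ?A y) \<partial>lebesgue) < \<infinity>"
      using fin by simp
    fix y :: "real^'n" assume y: "y \<in> - ball 0 3"
    then have g: "Ck_on m (ball 0 1) (\<lambda>x. K x y)"
      using K by (simp add: kernel_class_def)
    have "mderiv (count_list w) (\<lambda>x. K x y) 0 = pderivs w (\<lambda>x. K x y) 0"
      using w by (intro Ck_on_mderiv_eq_pderivs[OF g]) auto
    moreover have "\<bar>\<tau> y * u y * a\<bar> \<le> \<bar>u y\<bar> * \<bar>a\<bar>" for a
      using \<tau> by (auto simp: cutoff_def abs_mult intro!: mult_right_mono mult_left_le_one_le)
    moreover have "y \<in> ?A" if "\<tau> y \<noteq> 0"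
      using R[OF that] y by (auto simp: R'_def)
    ultimately show "ennreal \<bar>\<tau> y * u y * pderivs w (\<lambda>x. K x y) 0\<bar> \<le> ennreal 1 * (?F (count_list w) y * indicator ?A y)"
      by (cases "\<tau> y = 0") (auto intro: ennreal_leI)
  qed auto
qed

text \<open>The principal value is the limit along the radii 1/(n+1) of truncated integrals, each
  measurable in \<open>x\<close> because the truncated region is closed in the product space. The
  indicator is needed because convergence is known only on \<open>U\<close>.\<close>

lemma pv_integral_measurable:
  fixes H :: "real^'n::finite \<Rightarrow> real^'n \<Rightarrow> real"
  assumes H: "(\<lambda>(x, y). H x y) \<in> borel_measurable lebesgue" and U: "U \<in> sets lebesgue"
    and pv: "\<And>x. x \<in> U \<Longrightarrow> has_pv_integral (H x) (I x) x UNIV"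
  shows "(\<lambda>x. indicator U x * I x) \<in> borel_measurable lebesgue"
proof (rule borel_measurable_LIMSEQ_real)
  define F where "F n x = (LINT y|lebesgue. indicator (- ball x (1 / real (Suc n))) y *\<^sub>R H x y)" for n x
  have Fm: "F n \<in> borel_measurable lebesgue" for n
  proof -
    have "closed {z :: (real^'n) \<times> (real^'n). 1 / real (Suc n) \<le> dist (fst z) (snd z)}"
      by (intro closed_Collect_le continuous_intros)
    then have "{z :: (real^'n) \<times> (real^'n). 1 / real (Suc n) \<le> dist (fst z) (snd z)} \<in> sets lebesgue"
      by auto
    then have "(\<lambda>z. indicator {z. 1 / real (Suc n) \<le> dist (fst z) (snd z)} z *\<^sub>R (\<lambda>(x, y). H x y) z)
        \<in> borel_measurable lebesgue"
      using H by measurable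
    from borel_measurable_lebesgue_section_integral[OF this]
    have m: "(\<lambda>x. LINT y|lebesgue. indicator {z. 1 / real (Suc n) \<le> dist (fst z) (snd z)} (x, y) *\<^sub>R H x y)
        \<in> borel_measurable lebesgue" by simp
    have "indicator {z. 1 / real (Suc n) \<le> dist (fst z) (snd z)} (x, y)
        = (indicator (- ball x (1 / real (Suc n))) y :: real)" for x y :: "real^'n"
      by (auto simp: indicator_def)
    with m show ?thesis by (simp add: F_def[abs_def])
  qed
  show "(\<lambda>x. indicator U x * F n x) \<in> borel_measurable lebesgue" for n
    using Fm U by measurable
  fix x
  show "(\<lambda>n. indicator U x * F n x) \<longlonglongrightarrow> indicator U x * I x"
  proof (cases "x \<in> U")
    case True
    have "filterlim (\<lambda>n. 1 / real (Suc n)) (at_right 0) sequentially"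
      using LIMSEQ_Suc[OF lim_1_over_n[where 'a = real]]
      by (auto simp: filterlim_at intro!: always_eventually)
    from filterlim_compose[OF _ this] pv[OF True]
    have "(\<lambda>n. LINT y:(UNIV - ball x (1 / real (Suc n)))|lebesgue. H x y) \<longlonglongrightarrow> I x"
      unfolding has_pv_integral_def by blast
    then show ?thesis
      using True by (simp add: F_def set_lebesgue_integral_def Compl_eq_Diff_UNIV)
  qed simp
qed

section \<open>Assembly of the decomposition\<close>

theorem theorem2p1:
  fixes m :: nat
  shows "\<exists>C :: nat \<Rightarrow> real. (\<forall>k. C k > 0) \<and>
    (\<forall>\<theta>\<in>{0..2}. \<forall>K :: real^'n::finite \<Rightarrow> real^'n \<Rightarrow> real. \<forall>u \<tau>.
       K \<in> kernel_class m \<theta> \<longrightarrow> u \<in> C_class_K m \<theta> K \<longrightarrow> cutoff \<tau> \<longrightarrow>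
       (\<exists>f P. f \<in> borel_measurable lebesgue \<and> poly_deg_less m P \<and>
          (\<forall>x\<in>ball 0 1. A_defined K (\<lambda>y. \<tau> y * u y) x \<and>
                          A_op K (\<lambda>y. \<tau> y * u y) x = P x + f x) \<and>
          (\<exists>\<psi> :: real^'n \<Rightarrow> real^'n \<Rightarrow> real.
             (\<lambda>(x, y). \<psi> x y) \<in> borel_measurable (lebesgue_on (ball 0 1 \<times> (- ball 0 3))) \<and>
             (\<forall>\<gamma>. \<forall>y\<in>- ball 0 3.
                sup_mderiv (ball 0 1) \<gamma> (\<lambda>x. \<psi> x y)
                  \<le> ennreal (C (msize \<gamma>)) *
                    (SUP \<eta>\<in>{\<eta>. m \<le> msize \<eta> \<and> msize \<eta> \<le> m + msize \<gamma>}.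
                       sup_mderiv (ball 0 1) \<eta> (\<lambda>x. K x y))) \<and>
             (\<forall>x\<in>ball 0 1. decomposition_converges K \<psi> u \<tau> x \<and>
                f x = f1 K u x + f2 K u x + f_star \<psi> u \<tau> x))))"
proof (intro exI[of _ "\<lambda>_::nat. real CARD('n) ^ m"] conjI allI ballI impI)
  show "0 < real CARD('n) ^ m" by simp
next
  fix \<theta> :: real and K :: "real^'n \<Rightarrow> real^'n \<Rightarrow> real" and u \<tau> :: "real^'n \<Rightarrow> real"
  assume \<theta>: "\<theta> \<in> {0..2}" and K: "K \<in> kernel_class m \<theta>"
    and uK: "u \<in> C_class_K m \<theta> K" and \<tau>: "cutoff \<tau>"
  let ?N = "- ball (0 :: real^'n) 3"
  define v where "v y = \<tau> y * u y" for y
  define \<psi> where "\<psi> x y = taylor_defect m (\<lambda>x. K x y) x" for x y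
  define c where "c w = (LINT y:?N|lebesgue. \<tau> y * u y * pderivs w (\<lambda>x. K x y) 0)" for w
  define T where "T x = (\<Sum>k<m. word_sum k c x / fact k)" for x
  \<comment> \<open>With P = -T the identity A(\<tau> u) = P + f holds by construction, and
    measurability of \<open>f\<close> reduces to that of a single principal value. The splitting
    into three terms is what remains to be shown.\<close>
  define f where "f x = (if x \<in> ball 0 1 then A_op K v x + T x else 0)" for x
  have u: "u \<in> C_class \<theta>" using uK by (simp add: C_class_K_def)
  have um: "u \<in> borel_measurable lebesgue" using u by (simp add: C_class_def L1_loc_def)
  have \<tau>m: "\<tau> \<in> borel_measurable lebesgue" using \<tau> by (simp add: cutoff_def)
  have vm: "v \<in> borel_measurable lebesgue"
    unfolding v_def using um \<tau>m by (intro borel_measurable_times)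
  have v: "v y = u y" if "y \<in> ball 0 3" for y
    using \<tau> that by (simp add: cutoff_def v_def)

  have intK: "set_integrable lebesgue ?N (K x)" if x: "x \<in> ball 0 1" for x
  proof -
    have "?N \<inter> ball x 2 = {}"
    proof -
      have "norm y < 3" if "dist x y < 2" for y
        using norm_triangle_ineq[of x "y - x"] x that by (simp add: dist_norm norm_minus_commute)
      then show ?thesis by force
    qed
    from kernel_set_integrable_away[OF K x _ _ _ this, of "\<lambda>_. 1" 1]
    show ?thesis using \<theta> by auto
  qed
  have int\<psi>: "set_integrable lebesgue ?N (\<lambda>y. \<tau> y * u y * \<psi> x y)" if x: "x \<in> ball 0 1" for x
    unfolding \<psi>_def by (rule taylor_defect_kernel_integrable[OF K uK \<tau> x])
  \<comment> \<open>Integrating the Taylor polynomial of the kernel against \<open>\<tau> u\<close>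
    replaces each coefficient by its moment \<open>c w\<close>, which gives \<open>T x\<close>, for
    every \<open>x\<close> and not only in the unit ball.\<close>
  have intT: "has_bochner_integral lebesgue
      (\<lambda>y. indicator ?N y *\<^sub>R (\<tau> y * u y * (\<Sum>k<m. word_sum k (\<lambda>w. pderivs w (\<lambda>x. K x y) 0) x / fact k))) (T x)" for x
  proof -
    have "has_bochner_integral lebesgue
        (\<lambda>y. \<Sum>k<m. word_sum k (\<lambda>w. indicator ?N y *\<^sub>R (\<tau> y * u y * pderivs w (\<lambda>x. K x y) 0)) x / fact k) (T x)"
      unfolding T_def
    proof (intro has_bochner_integral_sum has_bochner_integral_divide has_bochner_integral_word_sum)
      fix k and w :: "'n list" assume "k \<in> {..<m}" "length w = k"
      then have "set_integrable lebesgue ?N (\<lambda>y. \<tau> y * u y * pderivs w (\<lambda>x. K x y) 0)"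
        by (intro kernel_derivative_moment_integrable[OF K uK \<tau>]) simp
      then show "has_bochner_integral lebesgue (\<lambda>y. indicator ?N y *\<^sub>R (\<tau> y * u y * pderivs w (\<lambda>x. K x y) 0)) (c w)"
        unfolding c_def set_integrable_def set_lebesgue_integral_def
        by (rule has_bochner_integral_integrable)
    qed
    moreover have "word_sum k (\<lambda>w. indicator ?N y *\<^sub>R (\<tau> y * u y * pderivs w (\<lambda>x. K x y) 0)) x
        = indicator ?N y *\<^sub>R (\<tau> y * u y * word_sum k (\<lambda>w. pderivs w (\<lambda>x. K x y) 0) x)" for k y
      using word_sum_scale[of k "indicator ?N y * (\<tau> y * u y)"] by (simp add: mult.assoc)
    ultimately show ?thesis
      by (simp add: sum_distrib_left sum_divide_distrib[symmetric] mult.assoc)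
  qed

  have main: "has_pv_integral (\<lambda>y. (v x - v y) * K x y)
      (f1 K u x + f2 K u x + f_star \<psi> u \<tau> x - T x) x UNIV"
    and pvb: "pv_integrable (\<lambda>y. (u x - u y) * K x y) x (ball 0 3)" if x: "x \<in> ball 0 1" for x
  proof -
    obtain l where l: "has_pv_integral (\<lambda>y. (u x - u y) * K x y) l x (ball 0 3)"
      using pv_integrable_ball[OF K u _ x] \<theta> by auto
    then show "pv_integrable (\<lambda>y. (u x - u y) * K x y) x (ball 0 3)"
      by (auto simp: pv_integrable_def)
    have vx: "v x = u x" using x by (intro v) simp
    have l': "has_pv_integral (\<lambda>y. (v x - v y) * K x y) (f1 K u x) x (ball 0 3)"
      using l has_pv_integral_cong[of "ball 0 3" "\<lambda>y. (u x - u y) * K x y" "\<lambda>y. (v x - v y) * K x y"] v vx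
      by (simp add: f1_def pv_integral_eq[OF l])
    have "has_bochner_integral lebesgue
        (\<lambda>y. u x * (indicator ?N y *\<^sub>R K x y) + indicator ?N y *\<^sub>R (\<tau> y * u y * \<psi> x y)
          - indicator ?N y *\<^sub>R (\<tau> y * u y * (\<Sum>k<m. word_sum k (\<lambda>w. pderivs w (\<lambda>x. K x y) 0) x / fact k)))
        (f2 K u x + f_star \<psi> u \<tau> x - T x)"
      unfolding f2_def f_star_def set_lebesgue_integral_def
      using intK[OF x] int\<psi>[OF x] unfolding set_integrable_def
      by (intro has_bochner_integral_diff has_bochner_integral_add has_bochner_integral_mult_right
          intT has_bochner_integral_integrable)
    \<comment> \<open>Since -K is \<psi> minus the Taylor polynomial, the term -\<tau> u K
      contributes \<open>f_star\<close> with a plus sign and \<open>T\<close> with a minus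
      sign.\<close>
    also have "(\<lambda>y. u x * (indicator ?N y *\<^sub>R K x y) + indicator ?N y *\<^sub>R (\<tau> y * u y * \<psi> x y)
          - indicator ?N y *\<^sub>R (\<tau> y * u y * (\<Sum>k<m. word_sum k (\<lambda>w. pderivs w (\<lambda>x. K x y) 0) x / fact k)))
        = (\<lambda>y. indicator ?N y *\<^sub>R ((v x - v y) * K x y))"
      unfolding \<psi>_def taylor_defect_def vx by (auto simp: v_def indicator_def algebra_simps)
    finally have N: "set_integrable lebesgue ?N (\<lambda>y. (v x - v y) * K x y)"
      "(LINT y:?N|lebesgue. (v x - v y) * K x y) = f2 K u x + f_star \<psi> u \<tau> x - T x"
      by (auto simp: set_integrable_def set_lebesgue_integral_def has_bochner_integral_iff)
    have "?N \<inter> ball x 1 = {}"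
    proof -
      have "norm y < 3" if "dist x y < 1" for y
        using norm_triangle_ineq[of x "y - x"] x that by (simp add: dist_norm norm_minus_commute)
      then show ?thesis by force
    qed
    from has_pv_integral_Un[OF l' N(1) _ _ this]
    show "has_pv_integral (\<lambda>y. (v x - v y) * K x y) (f1 K u x + f2 K u x + f_star \<psi> u \<tau> x - T x) x UNIV"
      unfolding N(2) by (simp add: algebra_simps)
  qed
  have A: "A_op K v x = f1 K u x + f2 K u x + f_star \<psi> u \<tau> x - T x" if "x \<in> ball 0 1" for x
    unfolding A_op_def by (rule pv_integral_eq[OF main[OF that]])

  have fm: "f \<in> borel_measurable lebesgue"
  proof -
    have "(\<lambda>z. (v (fst z) - v (snd z)) * K (fst z) (snd z)) \<in> borel_measurable lebesgue"
      using K measurable_compose[OF measurable_fst_lebesgue vm] measurable_compose[OF measurable_snd_lebesgue vm]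
      by (intro borel_measurable_times borel_measurable_diff) (auto simp: kernel_class_def case_prod_beta')
    then have Am: "(\<lambda>x. indicator (ball 0 1) x * A_op K v x) \<in> borel_measurable lebesgue"
      by (intro pv_integral_measurable[where H = "\<lambda>x y. (v x - v y) * K x y"])
         (auto simp: case_prod_beta' A main)
    have Tm: "T \<in> borel_measurable lebesgue"
    proof -
      have "(\<lambda>x :: real^'n. x $ i) \<in> borel_measurable lebesgue" for i
        by (intro measurable_completion) (simp add: borel_measurable_continuous_onI continuous_on_component continuous_on_id)
      then show ?thesis
        unfolding T_def
        by (intro borel_measurable_sum borel_measurable_divide borel_measurable_word_sum borel_measurable_const)
    qed
    have f: "f = (\<lambda>x. indicator (ball 0 1) x * A_op K v x + indicator (ball 0 1) x * T x)"
      by (auto simp: f_def)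
    have im: "indicator (ball 0 1) \<in> borel_measurable (lebesgue :: (real^'n) measure)"
      by (intro borel_measurable_indicator) simp
    show ?thesis
      unfolding f by (rule borel_measurable_add[OF Am borel_measurable_times[OF im Tm]])
  qed
  have poly: "poly_deg_less m (\<lambda>x. - T x)"
  proof -
    have "poly_deg_less m (\<lambda>x. \<Sum>k<m. (- (1 / fact k)) * word_sum k c x)"
      by (intro poly_deg_less_sum poly_deg_less_cmult poly_deg_less_mono[OF poly_deg_less_word_sum]) auto
    then show ?thesis by (simp add: T_def sum_negf)
  qed
  have defd: "A_defined K v x" if "x \<in> ball 0 1" for x
    using main[OF that] by (auto simp: A_defined_def pv_integrable_def)

  show "\<exists>f P. f \<in> borel_measurable lebesgue \<and> poly_deg_less m P \<and>
      (\<forall>x\<in>ball 0 1. A_defined K (\<lambda>y. \<tau> y * u y) x \<and> A_op K (\<lambda>y. \<tau> y * u y) x = P x + f x) \<and>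
      (\<exists>\<psi> :: real^'n \<Rightarrow> real^'n \<Rightarrow> real.
         (\<lambda>(x, y). \<psi> x y) \<in> borel_measurable (lebesgue_on (ball 0 1 \<times> (- ball 0 3))) \<and>
         (\<forall>\<gamma>. \<forall>y\<in>- ball 0 3.
            sup_mderiv (ball 0 1) \<gamma> (\<lambda>x. \<psi> x y)
              \<le> ennreal (real CARD('n) ^ m) *
                (SUP \<eta>\<in>{\<eta>. m \<le> msize \<eta> \<and> msize \<eta> \<le> m + msize \<gamma>}.
                   sup_mderiv (ball 0 1) \<eta> (\<lambda>x. K x y))) \<and>
         (\<forall>x\<in>ball 0 1. decomposition_converges K \<psi> u \<tau> x \<and>
            f x = f1 K u x + f2 K u x + f_star \<psi> u \<tau> x))"
    unfolding v_def[abs_def, symmetric]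
  proof (rule exI[of _ f], rule exI[of _ "\<lambda>x. - T x"], intro conjI ballI exI[of _ \<psi>] allI)
    show "(\<lambda>(x, y). \<psi> x y) \<in> borel_measurable (lebesgue_on (ball 0 1 \<times> (- ball 0 3)))"
      unfolding \<psi>_def by (rule taylor_defect_kernel_measurable[OF K])
  next
    fix \<gamma> :: "'n \<Rightarrow> nat" and y :: "real^'n" assume "y \<in> - ball 0 3"
    then have "Ck_on m (ball 0 1) (\<lambda>x. K x y)"
      using K by (simp add: kernel_class_def)
    from sup_mderiv_taylor_defect[OF this, of \<gamma>]
    show "sup_mderiv (ball 0 1) \<gamma> (\<lambda>x. \<psi> x y) \<le> ennreal (real CARD('n) ^ m) *
        (SUP \<eta>\<in>{\<eta>. m \<le> msize \<eta> \<and> msize \<eta> \<le> m + msize \<gamma>}. sup_mderiv (ball 0 1) \<eta> (\<lambda>x. K x y))"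
      by (simp add: \<psi>_def)
  qed (use fm poly defd A pvb intK int\<psi> in \<open>auto simp: f_def decomposition_converges_def\<close>)
qed

end
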